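(* Let $\Omega\subset\mathbb R^d$ be a bounded convex body and let $P(D)=D^2+q$ with a constant $q\in\mathbb R$. Then $$R_n\big(W^{P(D)}_\infty(\Omega)\big)= \frac14\left(\frac{\Theta(d)\,\mu_d(\Omega)}{\nu_d\, n}\right)^{2/d}(1+o(1))\qquad (n\to\infty),$$ i.e. $\lim_{n\to\infty} n^{2/d}R_n\big(W^{P(D)}_\infty(\Omega)\big)= \frac14\left(\frac{\Theta(d)\mu_d(\Omega)}{\nu_d}\right)^{2/d}$.
   Context: A convex body is a compact convex set with non-empty interior. $\mu_d$ is Lebesgue measure on $\mathbb R^d$, $\nu_d$ the volume of the unit ball of $\mathbb R^d$. Function class: for a convex body $\Omega$ and $P(D)=D^2+pD+q$, $W^{P(D)}_\infty(\Omega)$ is the set of $f:\Omega\to\mathbb R$ such that $f\in C^1(\Omega)$ and, for every unit vector $u\in\mathbb R^d$, the second directional derivative $\partial^2 f/\partial u^2$ exists in the generalized sense (for almost every line parallel to $u$ meeting the interior of $\Omega$, the restriction of $\partial f/\partial u$ to that line is locally absolutely continuous), and $\operatorname{ess\,sup}_{x\in\Omega}\big|\frac{\partial^2 f}{\partial u^2}(x)+p\frac{\partial f}{\partial u}(x)+qf(x)\big|\le1$. (Here $p=0$.) Recovery: for a finite set $\xi\subset\Omega$, the information is $I_\xi(f)=\{(f(x),\nabla f(x)):x\in\xi\}$. An algorithm is any map $\phi$ from the information to $C(\Omega)$. $R(W^{P(D)}_\infty(\Omega),\xi)=\inf_\phi\sup_{f\in W^{P(D)}_\infty(\Omega)}\|f-\phi(I_\xi(f))\|_\infty$,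 and $R_n(W^{P(D)}_\infty(\Omega))=\inf\{R(W^{P(D)}_\infty(\Omega),\xi):\xi\subset\Omega,\ \operatorname{card}\xi\le n\}$. Covering density: a covering of $\mathbb R^d$ is a countable family $\mathcal M$ of balls of equal radius whose union is $\mathbb R^d$; $\operatorname{dens}\mathcal M=\liminf_{R\to\infty}\sum_{B\in\mathcal M}\mu_d(B\cap[-R,R]^d)/\mu_d([-R,R]^d)$, and $\Theta(d)=\inf\{\operatorname{dens}\mathcal M:\mathcal M\text{ covers }\mathbb R^d\}$. *)

theory Defs
  imports "HOL-Analysis.Analysis"
begin

definition abs_cont_on :: "real set \<Rightarrow> (real \<Rightarrow> real) \<Rightarrow> bool" where
  "abs_cont_on S h \<longleftrightarrow>
     (\<forall>e>0. \<exists>\<delta>>0. \<forall>(n::nat) (a::nat \<Rightarrow> real) b.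
        (\<forall>i<n. a i \<le> b i \<and> {a i..b i} \<subseteq> S) \<and>
        (\<forall>i<n. \<forall>j<n. i \<noteq> j \<longrightarrow> b i \<le> a j \<or> b j \<le> a i) \<and>
        (\<Sum>i<n. b i - a i) < \<delta>
        \<longrightarrow> (\<Sum>i<n. \<bar>h (b i) - h (a i)\<bar>) < e)"

definition loc_abs_cont_on :: "real set \<Rightarrow> (real \<Rightarrow> real) \<Rightarrow> bool" where
  "loc_abs_cont_on I h \<longleftrightarrow> (\<forall>a b. {a..b} \<subseteq> I \<longrightarrow> abs_cont_on {a..b} h)"

text \<open>The class W^{P(D)}_infty(Omega) for P(D) = D^2 + pD + q. The gradient g of f on Omega
  is continuous (f in C^1(Omega)); df/du = g . u. "Almost every line parallel to u meeting the
  interior" is expressed as "for Lebesgue-a.e. x in the interior, the line through x".\<close>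
definition W_class :: "'a::euclidean_space set \<Rightarrow> real \<Rightarrow> real \<Rightarrow> ('a \<Rightarrow> real) set" where
  "W_class \<Omega> p q = {f. \<exists>g::'a \<Rightarrow> 'a.
      (\<forall>x\<in>\<Omega>. (f has_derivative (\<lambda>h. g x \<bullet> h)) (at x within \<Omega>)) \<and>
      continuous_on \<Omega> g \<and>
      (\<forall>u::'a. norm u = 1 \<longrightarrow>
         (AE x in lebesgue. x \<in> interior \<Omega> \<longrightarrow>
             loc_abs_cont_on {t. x + t *\<^sub>R u \<in> interior \<Omega>} (\<lambda>t. g (x + t *\<^sub>R u) \<bullet> u)) \<and>
         (AE x in lebesgue. x \<in> \<Omega> \<longrightarrow>
             (\<exists>s. ((\<lambda>t. g (x + t *\<^sub>R u) \<bullet> u) has_real_derivative s) (at 0) \<and>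
                  \<bar>s + p * (g x \<bullet> u) + q * f x\<bar> \<le> 1)))}"

text \<open>Gradient of f on Omega (unique for convex bodies).\<close>
definition grad_on :: "'a::euclidean_space set \<Rightarrow> ('a \<Rightarrow> real) \<Rightarrow> 'a \<Rightarrow> 'a" where
  "grad_on \<Omega> f x = (SOME v. (f has_derivative (\<lambda>h. v \<bullet> h)) (at x within \<Omega>))"

definition info :: "'a::euclidean_space set \<Rightarrow> 'a set \<Rightarrow> ('a \<Rightarrow> real) \<Rightarrow> 'a \<Rightarrow> real \<times> 'a" where
  "info \<Omega> \<xi> f = (\<lambda>x. if x \<in> \<xi> then (f x, grad_on \<Omega> f x) else (0, 0))"

definition recovery_error :: "'a::euclidean_space set \<Rightarrow> real \<Rightarrow> real \<Rightarrow> 'a set \<Rightarrow> ereal" where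
  "recovery_error \<Omega> p q \<xi> =
     (INF \<phi> \<in> {\<phi> :: ('a \<Rightarrow> real \<times> 'a) \<Rightarrow> 'a \<Rightarrow> real. \<forall>I. continuous_on \<Omega> (\<phi> I)}.
        SUP f \<in> W_class \<Omega> p q. SUP x \<in> \<Omega>. ereal \<bar>f x - \<phi> (info \<Omega> \<xi> f) x\<bar>)"

definition optimal_recovery :: "'a::euclidean_space set \<Rightarrow> real \<Rightarrow> real \<Rightarrow> nat \<Rightarrow> ereal" where
  "optimal_recovery \<Omega> p q n =
     (INF \<xi> \<in> {\<xi>. finite \<xi> \<and> \<xi> \<subseteq> \<Omega> \<and> card \<xi> \<le> n}. recovery_error \<Omega> p q \<xi>)"

definition covering_density :: "'a::euclidean_space set \<Rightarrow> real \<Rightarrow> ennreal" where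
  "covering_density C r =
     liminf (\<lambda>R::real. (\<integral>\<^sup>+ c. emeasure lborel (cball c r \<inter> cbox (- R *\<^sub>R One) (R *\<^sub>R One))
                              \<partial>count_space C)
                        / emeasure lborel (cbox (- R *\<^sub>R One) (R *\<^sub>R (One::'a))))"

definition Theta :: "'a::euclidean_space itself \<Rightarrow> ennreal" where
  "Theta _ = (INF Cr \<in> {(C :: 'a set, r::real). countable C \<and> r > 0 \<and> (\<Union>c\<in>C. cball c r) = UNIV}.
                covering_density (fst Cr) (snd Cr))"

end

theory Submission
  imports Defs
begin

text \<open>Two bounds for the recovery error from a node set \<open>\<xi>\<close> are combined with two bounds for covering numbers.

  If every point of \<open>\<Omega>\<close> is within \<open>h\<close> of \<open>\<xi>\<close>, and every boundary point within \<open>h/2\<close>, then a function of the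
  class with vanishing data is bounded by \<open>(h\<^sup>2/4) / (1 - \<bar>q\<bar> h\<^sup>2/4)\<close>, and recovery by the centre of the
  fibre over the data has this error. Conversely, around a point at distance more than \<open>h\<close> from \<open>\<xi>\<close>
  one can place a radial \<open>C\<^sup>1\<close> bump of height \<open>h\<^sup>2/4\<close> whose Hessian has eigenvalues in \<open>[-1, 1]\<close>; up to the factor
  \<open>1 + \<bar>q\<bar> h\<^sup>2/4\<close> it lies in the class, and it cannot be told apart from its negative.

  The number of balls of radius \<open>h\<close> needed to cover a compact convex set is asymptotically
  \<open>\<Theta>(d) \<mu>(\<Omega>) / (\<nu> h\<^sup>d)\<close>. Both estimates come from averaging over translates: a small cube moving inside
  \<open>\<Omega>\<close> always meets as many balls as a periodic covering of density at least \<open>\<Theta>(d)\<close> requires, and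
  \<open>\<Omega>\<close> moving inside a thin covering of the whole space meets, in a suitable position, at most the average
  number of balls. The refinement near the boundary costs only \<open>o(h\<^sup>-\<^sup>d)\<close> nodes, and projecting nodes onto
  \<open>\<Omega>\<close> brings them closer to all its points.\<close>

section \<open>Second derivatives along lines\<close>

text \<open>The constant q acts as a perturbation: q f shifts the bound on second derivatives by at
  most |q| sup |f|, and sup |f| is itself O(h^2) once the data vanish, so the inequality for the
  supremum closes on itself and leaves a factor tending to 1. The constant 1/4 has one source on
  both sides: two parabolic arcs of curvature -1 and 1, each over half the distance h, joined with
  matching slope. They form the radial profile of the bump, and the two Taylor remainders of the
  upper bound reproduce them. Second derivatives exist only almost everywhere and line by line.
  Hence the estimates go through the gradient: a bound on almost every line extends to every pair of
  points by continuity of the gradient. \<open>Theta\<close> is an infimum of lower limits. A nearly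
  optimal covering is controlled only on some large cubes, may be very uneven inside them, and has a
  radius that is not at one's disposal. Dilation adjusts the radius; averaging is used because no
  particular translate can be trusted.\<close>

text \<open>Cousin's lemma: in a fine tagged division the intervals tagged outside \<open>N\<close> contribute at most
  \<open>(M + e) (b - a)\<close>, and those tagged in \<open>N\<close> have small total length, so absolute continuity controls them.\<close>

lemma abs_cont_on_bounded_deriv:
  fixes h :: "real \<Rightarrow> real"
  assumes ab: "a \<le> b" and ac: "abs_cont_on {a..b} h" and N: "negligible N" and M: "0 \<le> M"
    and der: "\<And>t. \<lbrakk>t \<in> {a..b}; t \<notin> N\<rbrakk> \<Longrightarrow>
                \<exists>s. (h has_real_derivative s) (at t within {a..b}) \<and> \<bar>s\<bar> \<le> M"
  shows "\<bar>h b - h a\<bar> \<le> M * (b - a)"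
proof -
  have main: "\<bar>h b - h a\<bar> \<le> (M + e) * (b - a) + e" if e: "e > 0" for e
  proof -
    from ac e obtain \<delta> where \<delta>: "\<delta> > 0" and AC: "\<forall>(n::nat) (l::nat \<Rightarrow> real) u.
        (\<forall>i<n. l i \<le> u i \<and> {l i..u i} \<subseteq> {a..b}) \<and>
        (\<forall>i<n. \<forall>j<n. i \<noteq> j \<longrightarrow> u i \<le> l j \<or> u j \<le> l i) \<and>
        (\<Sum>i<n. u i - l i) < \<delta>
        \<longrightarrow> (\<Sum>i<n. \<bar>h (u i) - h (l i)\<bar>) < e"
      unfolding abs_cont_on_def by (elim allE[of _ e] impE exE conjE) (assumption, rule that)
    obtain U where U: "open U" "N \<subseteq> U" "U - N \<in> lmeasurable" "emeasure lebesgue (U - N) < ennreal \<delta>"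
      using sets_lebesgue_outer_open[of N \<delta>] N \<delta> negligible_imp_sets by metis
    have Nlm: "N \<in> lmeasurable" "N \<in> null_sets lebesgue"
      using N by (simp add: negligible_iff_measure, simp add: negligible_iff_null_sets)
    have UN: "U = (U - N) \<union> N" using U(2) by auto
    have Ulm: "U \<in> lmeasurable"
      by (subst UN) (intro fmeasurable.Un U(3) Nlm)
    have "measure lebesgue U = measure lebesgue (U - N)"
      by (subst UN, rule measure_Un_null_set) (use U(3) Nlm in auto)
    also have "\<dots> < \<delta>"
      using U(4) \<delta> by (simp add: emeasure_eq_measure2[OF U(3)] ennreal_less_iff)
    finally have mU: "measure lebesgue U < \<delta>" .
    have "\<exists>d>0. \<forall>y\<in>{a..b}. \<bar>y - t\<bar> < d \<longrightarrow> \<bar>h y - h t\<bar> \<le> (M + e) * \<bar>y - t\<bar>"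
      if t: "t \<in> {a..b}" "t \<notin> N" for t
    proof -
      obtain s where s: "(h has_real_derivative s) (at t within {a..b})" "\<bar>s\<bar> \<le> M"
        using der t by blast
      from s(1) have "(h has_derivative (\<lambda>x. s * x)) (at t within {a..b})"
        by (simp add: has_field_derivative_def)
      then obtain d where d: "d > 0" "\<And>y. \<lbrakk>y \<in> {a..b}; norm (y - t) < d\<rbrakk> \<Longrightarrow>
            norm (h y - h t - s * (y - t)) \<le> e * norm (y - t)"
        unfolding has_derivative_within_alt using e by meson
      have "\<bar>h y - h t\<bar> \<le> (M + e) * \<bar>y - t\<bar>" if "y \<in> {a..b}" "\<bar>y - t\<bar> < d" for y
      proof -
        have "\<bar>h y - h t - s * (y - t)\<bar> \<le> e * \<bar>y - t\<bar>" using d(2) that by simp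
        moreover have "\<bar>s * (y - t)\<bar> \<le> M * \<bar>y - t\<bar>"
          using s(2) by (simp add: abs_mult mult_right_mono)
        ultimately show ?thesis by (simp add: algebra_simps)
      qed
      then show ?thesis using d(1) by blast
    qed
    then obtain d where d: "\<And>t. \<lbrakk>t \<in> {a..b}; t \<notin> N\<rbrakk> \<Longrightarrow> d t > 0"
      "\<And>t y. \<lbrakk>t \<in> {a..b}; t \<notin> N; y \<in> {a..b}; \<bar>y - t\<bar> < d t\<rbrakk> \<Longrightarrow> \<bar>h y - h t\<bar> \<le> (M + e) * \<bar>y - t\<bar>"
      by metis
    \<comment> \<open>On \<open>N\<close> the gauge is the one small open set \<open>U\<close>, so
      that all intervals tagged there lie in it and have total length below \<delta>; elsewhere it
      is the radius from differentiability. The third case makes it a gauge on the whole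
      line.\<close>
    define \<gamma> where "\<gamma> t = (if t \<in> N then U else if t \<in> {a..b} then ball t (d t) else ball t 1)" for t
    have "gauge \<gamma>"
      unfolding gauge_def \<gamma>_def using U d(1) by auto
    then obtain p where p: "p tagged_division_of {a..b}" "\<gamma> fine p"
      using fine_division_exists_real by blast
    have fin: "finite p" using p(1) by blast
    define F where "F z = h (Sup (snd z)) - h (Inf (snd z))" for z :: "real \<times> real set"
    define len where "len z = Sup (snd z) - Inf (snd z)" for z :: "real \<times> real set"
    have sumF: "(\<Sum>z\<in>p. F z) = h b - h a"
      using additive_tagged_division_1[OF ab p(1), of h] by (simp add: F_def case_prod_beta)
    have sumlen: "(\<Sum>z\<in>p. len z) = b - a"
      using additive_tagged_division_1[OF ab p(1), of "\<lambda>x. x"] by (simp add: len_def case_prod_beta)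
    have piece: "\<And>y. y \<in> snd z \<longleftrightarrow> Inf (snd z) \<le> y \<and> y \<le> Sup (snd z)" "Inf (snd z) \<le> fst z" "fst z \<le> Sup (snd z)"
      "{Inf (snd z)..Sup (snd z)} \<subseteq> {a..b}" "snd z \<subseteq> \<gamma> (fst z)" if z: "z \<in> p" for z
    proof -
      obtain x K where zz: "z = (x, K)" by force
      have xK: "x \<in> K" "K \<subseteq> {a..b}" "\<exists>u v. K = cbox u v"
        using tagged_division_ofD[OF p(1)] z zz by blast+
      then obtain u v where uv: "K = {u..v}" by auto
      with xK have "u \<le> v" by auto
      then have "Inf K = u" "Sup K = v" using uv by auto
      then show "\<And>y. y \<in> snd z \<longleftrightarrow> Inf (snd z) \<le> y \<and> y \<le> Sup (snd z)" "Inf (snd z) \<le> fst z" "fst z \<le> Sup (snd z)"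
        "{Inf (snd z)..Sup (snd z)} \<subseteq> {a..b}" "snd z \<subseteq> \<gamma> (fst z)"
        using uv xK zz z p(2) by (auto simp: fine_def)
    qed
    have len0: "len z \<ge> 0" if "z \<in> p" for z
      using piece[OF that] by (simp add: len_def)
    \<comment> \<open>Degenerate intervals contribute 0 and are dropped: with positive lengths,
      disjoint interiors force the intervals to be ordered on the line, which is how
      \<open>abs_cont_on\<close> expresses non-overlapping.\<close>
    define p1 where "p1 = {z \<in> p. fst z \<in> N \<and> len z > 0}"
    define p2 where "p2 = {z \<in> p. fst z \<notin> N}"
    have sub: "p1 \<subseteq> p" "p2 \<subseteq> p" "p1 \<inter> p2 = {}" "finite p1" "finite p2"
      using fin by (auto simp: p1_def p2_def)
    have Fsplit: "(\<Sum>z\<in>p. F z) = (\<Sum>z\<in>p1. F z) + (\<Sum>z\<in>p2. F z)"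
    proof -
      have "(\<Sum>z\<in>p1 \<union> p2. F z) = (\<Sum>z\<in>p. F z)"
      proof (rule sum.mono_neutral_left)
        show "\<forall>z\<in>p - (p1 \<union> p2). F z = 0"
        proof
          fix z assume z: "z \<in> p - (p1 \<union> p2)"
          then have "len z = 0" using len0[of z] by (auto simp: p1_def p2_def)
          then show "F z = 0" by (simp add: len_def F_def)
        qed
      qed (use fin sub in auto)
      then show ?thesis using sum.union_disjoint[of p1 p2 F] sub by simp
    qed
    have b2: "\<bar>\<Sum>z\<in>p2. F z\<bar> \<le> (M + e) * (b - a)"
    proof -
      have "\<bar>F z\<bar> \<le> (M + e) * len z" if z: "z \<in> p2" for z
      proof -
        let ?l = "Inf (snd z)" and ?u = "Sup (snd z)" and ?t = "fst z"
        have zp: "z \<in> p" "?t \<notin> N" using z by (auto simp: p2_def)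
        note P = piece[OF zp(1)]
        have t: "?t \<in> {a..b}" using P(2-4) by auto
        have bl: "snd z \<subseteq> ball ?t (d ?t)" using P(5) zp t by (simp add: \<gamma>_def)
        have "?l \<in> snd z" "?u \<in> snd z" using P(1-3) by auto
        then have "\<bar>?l - ?t\<bar> < d ?t" "\<bar>?u - ?t\<bar> < d ?t" "?l \<in> {a..b}" "?u \<in> {a..b}"
          using bl P(2-4) by (auto simp: dist_real_def abs_minus_commute subset_iff)
        then have "\<bar>h ?l - h ?t\<bar> \<le> (M + e) * \<bar>?l - ?t\<bar>" "\<bar>h ?u - h ?t\<bar> \<le> (M + e) * \<bar>?u - ?t\<bar>"
          using d(2)[OF t zp(2)] by blast+
        moreover have "\<bar>?l - ?t\<bar> = ?t - ?l" "\<bar>?u - ?t\<bar> = ?u - ?t" using P(2,3) by auto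
        ultimately show ?thesis
          unfolding F_def len_def by (simp add: algebra_simps)
      qed
      then have "\<bar>\<Sum>z\<in>p2. F z\<bar> \<le> (\<Sum>z\<in>p2. (M + e) * len z)"
        by (intro order_trans[OF sum_abs sum_mono])
      also have "\<dots> \<le> (\<Sum>z\<in>p. (M + e) * len z)"
        using sub fin len0 M e by (intro sum_mono2) auto
      also have "\<dots> = (M + e) * (b - a)" by (simp flip: sum_distrib_left add: sumlen)
      finally show ?thesis .
    qed
    have b1: "(\<Sum>z\<in>p1. \<bar>F z\<bar>) < e"
    proof -
      obtain idx where idx: "bij_betw idx {..<card p1} p1"
        using ex_bij_betw_nat_finite[OF sub(4)] by (auto simp: atLeast0LessThan)
      let ?n = "card p1"
      define l where "l i = Inf (snd (idx i))" for i
      define u where "u i = Sup (snd (idx i))" for i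
      have ip: "idx i \<in> p1" if "i < ?n" for i using idx that by (auto simp: bij_betw_def)
      have lu: "l i < u i" if "i < ?n" for i
        using ip[OF that] by (simp add: p1_def len_def l_def u_def)
      have dis: "{l i<..<u i} \<inter> {l j<..<u j} = {}" if "i < ?n" "j < ?n" "i \<noteq> j" for i j
      proof -
        have ne: "idx i \<noteq> idx j" using idx that by (auto simp: bij_betw_def inj_on_def)
        have pp: "idx i \<in> p" "idx j \<in> p" using ip that sub by auto
        obtain x K x' K' where zz: "idx i = (x, K)" "idx j = (x', K')" by force
        have "interior K \<inter> interior K' = {}"
          using tagged_division_ofD(5)[OF p(1)] pp ne zz by metis
        moreover have "K = {l i..u i}" "K' = {l j..u j}"
          using piece(1)[OF pp(1)] piece(1)[OF pp(2)] unfolding l_def u_def zz set_eq_iff by simp_all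
        ultimately show ?thesis by simp
      qed
      have sep: "u i \<le> l j \<or> u j \<le> l i" if "i < ?n" "j < ?n" "i \<noteq> j" for i j
      proof (rule ccontr)
        assume "\<not> ?thesis"
        then have "max (l i) (l j) < min (u i) (u j)" using lu that by auto
        then obtain m where "max (l i) (l j) < m" "m < min (u i) (u j)" using dense by blast
        then have "m \<in> {l i<..<u i} \<inter> {l j<..<u j}" by auto
        then show False using dis that by blast
      qed
      have "(\<Sum>i<?n. u i - l i) = (\<Sum>i<?n. measure lebesgue {l i<..<u i})"
        using lu by (intro sum.cong refl) (simp add: less_imp_le)
      also have "\<dots> = measure lebesgue (\<Union>i<?n. {l i<..<u i})"
        by (rule measure_finite_Union[symmetric])
           (use dis lu in \<open>auto simp: disjoint_family_on_def less_imp_le\<close>)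
      also have "\<dots> \<le> measure lebesgue U"
      proof (rule measure_mono_fmeasurable)
        show "(\<Union>i<?n. {l i<..<u i}) \<subseteq> U"
        proof (rule UN_least)
          fix i assume "i \<in> {..<?n}"
          then have "idx i \<in> p" "fst (idx i) \<in> N" using ip by (auto simp: p1_def)
          then have "snd (idx i) \<subseteq> U" using piece(5)[of "idx i"] by (simp add: \<gamma>_def)
          then show "{l i<..<u i} \<subseteq> U" using piece(1)[OF \<open>idx i \<in> p\<close>]
            unfolding l_def u_def by (meson greaterThanLessThan_iff less_imp_le subset_iff)
        qed
      qed (use Ulm in auto)
      finally have small: "(\<Sum>i<?n. u i - l i) < \<delta>" using mU by simp
      have "(\<Sum>i<?n. \<bar>h (u i) - h (l i)\<bar>) < e"
      proof (rule AC[THEN spec, THEN spec, THEN spec, THEN mp], intro conjI)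
        show "\<forall>i<?n. l i \<le> u i \<and> {l i..u i} \<subseteq> {a..b}"
          using lu ip sub piece(4) unfolding l_def u_def by (metis less_imp_le subsetD)
      qed (use sep small in auto)
      also have "(\<Sum>i<?n. \<bar>h (u i) - h (l i)\<bar>) = (\<Sum>z\<in>p1. \<bar>F z\<bar>)"
        unfolding l_def u_def F_def by (rule sum.reindex_bij_betw[OF idx])
      finally show ?thesis .
    qed
    have "\<bar>h b - h a\<bar> \<le> (\<Sum>z\<in>p1. \<bar>F z\<bar>) + \<bar>\<Sum>z\<in>p2. F z\<bar>"
      using sumF Fsplit sum_abs[of F p1] by linarith
    then show ?thesis using b1 b2 by linarith
  qed
  show ?thesis
  proof (rule field_le_epsilon)
    fix e :: real assume e: "e > 0"
    have "\<bar>h b - h a\<bar> \<le> (M + e / (b - a + 1)) * (b - a) + e / (b - a + 1)"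
      by (rule main) (use e ab in auto)
    also have "\<dots> = M * (b - a) + e / (b - a + 1) * (b - a + 1)"
      by (simp only: distrib_right distrib_left mult_1_right)
    also have "\<dots> = M * (b - a) + e"
      using ab by simp
    finally show "\<bar>h b - h a\<bar> \<le> M * (b - a) + e" .
  qed
qed

section \<open>Directional Lipschitz bounds for the gradient\<close>

definition W_grad :: "'a::euclidean_space set \<Rightarrow> real \<Rightarrow> real \<Rightarrow> ('a \<Rightarrow> real) \<Rightarrow> ('a \<Rightarrow> 'a) \<Rightarrow> bool" where
  "W_grad \<Omega> p q f g \<longleftrightarrow>
      (\<forall>x\<in>\<Omega>. (f has_derivative (\<lambda>h. g x \<bullet> h)) (at x within \<Omega>)) \<and>
      continuous_on \<Omega> g \<and>
      (\<forall>u::'a. norm u = 1 \<longrightarrow>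
         (AE x in lebesgue. x \<in> interior \<Omega> \<longrightarrow>
             loc_abs_cont_on {t. x + t *\<^sub>R u \<in> interior \<Omega>} (\<lambda>t. g (x + t *\<^sub>R u) \<bullet> u)) \<and>
         (AE x in lebesgue. x \<in> \<Omega> \<longrightarrow>
             (\<exists>s. ((\<lambda>t. g (x + t *\<^sub>R u) \<bullet> u) has_real_derivative s) (at 0) \<and>
                  \<bar>s + p * (g x \<bullet> u) + q * f x\<bar> \<le> 1)))"

lemma W_class_iff: "f \<in> W_class \<Omega> p q \<longleftrightarrow> (\<exists>g. W_grad \<Omega> p q f g)"
  by (simp add: W_class_def W_grad_def)

text \<open>Each fixed translation maps null sets to null sets, so the exceptional pairs form a null
  set when sliced by t; Fubini lets them be sliced by x instead. This treats every direction
  \<open>u\<close> without coordinates adapted to it.\<close>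

lemma AE_AE_line:
  fixes u :: "'a::euclidean_space"
  assumes "AE x in lborel. P x"
  shows "AE x in lborel. AE t in lborel. P (x + t *\<^sub>R u)"
proof -
  obtain N where N: "\<And>x. x \<in> space lborel - N \<Longrightarrow> P x" "N \<in> null_sets lborel"
    using AE_E3[OF assms] by blast
  have [measurable]: "N \<in> sets borel" using N(2) by auto
  have "AE t in lborel. AE x in lborel. x + t *\<^sub>R u \<notin> N"
  proof (rule AE_I2)
    fix t :: real
    have "{x. x - (- (t *\<^sub>R u)) \<in> N} \<in> null_sets lborel"
      by (rule null_sets_translation[OF N(2)])
    then show "AE x in lborel. x + t *\<^sub>R u \<notin> N" by (intro AE_I') auto
  qed
  then have "AE x in lborel. AE t in lborel. x + t *\<^sub>R u \<notin> N"
    by (subst lborel_pair.AE_commute) measurable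
  then show ?thesis
    by (rule AE_mp) (rule AE_I2, rule impI, erule AE_mp, rule AE_I2, use N(1) in auto)
qed

lemma open_meets_AE:
  fixes S :: "'a::euclidean_space set"
  assumes "AE x in lebesgue. P x" "open S" "S \<noteq> {}"
  obtains x where "x \<in> S" "P x"
proof -
  obtain N where N: "\<And>x. x \<in> space lebesgue - N \<Longrightarrow> P x" "N \<in> null_sets lebesgue"
    using AE_E3[OF assms(1)] by blast
  have "\<not> S \<subseteq> N"
    using open_not_negligible[OF assms(2,3)] N(2) negligible_subset negligible_iff_null_sets by blast
  then show ?thesis using that N(1) by auto
qed

text \<open>A violation of the bound persists on an open set of \<open>x\<close>, hence occurs on a line along which the
  derivative is locally absolutely continuous and bounded almost everywhere.\<close>

lemma W_grad_interior:
  fixes \<Omega> :: "'a::euclidean_space set"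
  assumes conv: "convex \<Omega>" and W: "W_grad \<Omega> 0 q f g"
    and B: "\<And>x. x \<in> \<Omega> \<Longrightarrow> \<bar>f x\<bar> \<le> B" and u: "norm u = 1"
    and t: "0 \<le> t" and x: "x \<in> interior \<Omega>" and xt: "x + t *\<^sub>R u \<in> interior \<Omega>"
  shows "\<bar>(g (x + t *\<^sub>R u) - g x) \<bullet> u\<bar> \<le> (1 + \<bar>q\<bar> * B) * t"
proof (rule ccontr)
  let ?I = "interior \<Omega>" and ?L = "1 + \<bar>q\<bar> * B"
  assume viol: "\<not> ?thesis"
  define D where "D x \<longleftrightarrow> (x \<in> \<Omega> \<longrightarrow> (\<exists>s. ((\<lambda>t. g (x + t *\<^sub>R u) \<bullet> u) has_real_derivative s) (at 0) \<and>
                  \<bar>s + q * f x\<bar> \<le> 1))" for x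
  define S where "S = ?I \<inter> (\<lambda>y. y + t *\<^sub>R u) -` ?I"
  have oS: "open S"
    unfolding S_def by (intro open_Int open_interior open_vimage continuous_intros)
  have gI: "continuous_on ?I g"
    using W continuous_on_subset[OF _ interior_subset] by (auto simp: W_grad_def)
  have "continuous_on S (\<lambda>y. g (y + t *\<^sub>R u))"
    by (rule continuous_on_compose2[OF gI]) (auto simp: S_def intro!: continuous_intros)
  moreover have "continuous_on S g" using gI continuous_on_subset S_def by blast
  ultimately have "continuous_on S (\<lambda>y. \<bar>(g (y + t *\<^sub>R u) - g y) \<bullet> u\<bar>)"
    by (intro continuous_intros)
  then have "open (S \<inter> (\<lambda>y. \<bar>(g (y + t *\<^sub>R u) - g y) \<bullet> u\<bar>) -` {?L * t<..})"
    using oS by (intro continuous_open_preimage) auto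
  moreover have "S \<inter> (\<lambda>y. \<bar>(g (y + t *\<^sub>R u) - g y) \<bullet> u\<bar>) -` {?L * t<..} \<noteq> {}"
    using viol x xt by (auto simp: S_def)
  moreover have AE1: "AE x in lebesgue. x \<in> ?I \<longrightarrow>
             loc_abs_cont_on {t. x + t *\<^sub>R u \<in> ?I} (\<lambda>t. g (x + t *\<^sub>R u) \<bullet> u)"
    using W u by (simp add: W_grad_def)
  moreover have AE2: "AE x in lebesgue. AE t in lborel. D (x + t *\<^sub>R u)"
  proof -
    have "AE x in lebesgue. D x" using W u by (simp add: W_grad_def D_def)
    then have "AE x in lborel. D x" by (simp add: AE_completion_iff)
    then show ?thesis by (intro AE_completion AE_AE_line)
  qed
  ultimately obtain y where yP: "y \<in> S \<inter> (\<lambda>y. \<bar>(g (y + t *\<^sub>R u) - g y) \<bullet> u\<bar>) -` {?L * t<..}"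
    "(y \<in> ?I \<longrightarrow> loc_abs_cont_on {t. y + t *\<^sub>R u \<in> ?I} (\<lambda>t. g (y + t *\<^sub>R u) \<bullet> u)) \<and>
     (AE t in lborel. D (y + t *\<^sub>R u))"
    using open_meets_AE[OF AE_conjI[OF AE1 AE2]] by blast
  from yP have yS: "y \<in> S" and yv: "\<bar>(g (y + t *\<^sub>R u) - g y) \<bullet> u\<bar> > ?L * t"
    and yac: "y \<in> ?I \<longrightarrow> loc_abs_cont_on {t. y + t *\<^sub>R u \<in> ?I} (\<lambda>t. g (y + t *\<^sub>R u) \<bullet> u)"
    and yD: "AE t in lborel. D (y + t *\<^sub>R u)"
    by auto
  have "y \<in> \<Omega>" using yS interior_subset by (auto simp: S_def)
  then have B0: "0 \<le> B" using B[of y] by linarith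
  have seg: "{0..t} \<subseteq> {t. y + t *\<^sub>R u \<in> ?I}"
  proof
    fix r assume r: "r \<in> {0..t}"
    show "r \<in> {t. y + t *\<^sub>R u \<in> ?I}"
    proof (cases "t = 0")
      case True then show ?thesis using r yS by (auto simp: S_def)
    next
      case False
      then have "(1 - r/t) *\<^sub>R y + (r/t) *\<^sub>R (y + t *\<^sub>R u) \<in> ?I"
        using yS r t by (intro convexD[OF convex_interior[OF conv]]) (auto simp: S_def)
      moreover have "(1 - r/t) *\<^sub>R y + (r/t) *\<^sub>R (y + t *\<^sub>R u) = y + r *\<^sub>R u"
        using False by (simp add: algebra_simps)
      ultimately show ?thesis by simp
    qed
  qed
  obtain N where N: "\<And>r. r \<in> space lborel - N \<Longrightarrow> D (y + r *\<^sub>R u)" "N \<in> null_sets lborel"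
    using AE_E3[OF yD] by blast
  let ?h = "\<lambda>t. g (y + t *\<^sub>R u) \<bullet> u"
  have "\<bar>?h t - ?h 0\<bar> \<le> ?L * (t - 0)"
  proof (rule abs_cont_on_bounded_deriv[OF t])
    show "abs_cont_on {0..t} ?h"
      using yac yS seg unfolding S_def loc_abs_cont_on_def by blast
    show "negligible N" using N(2) null_sets_completionI negligible_iff_null_sets by blast
    show "0 \<le> ?L" using B0 by simp
    fix r assume r: "r \<in> {0..t}" "r \<notin> N"
    have yr: "y + r *\<^sub>R u \<in> \<Omega>" using seg r(1) interior_subset by blast
    then obtain s where s: "((\<lambda>t. g (y + r *\<^sub>R u + t *\<^sub>R u) \<bullet> u) has_real_derivative s) (at 0)"
      "\<bar>s + q * f (y + r *\<^sub>R u)\<bar> \<le> 1"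
      using N(1)[of r] r(2) unfolding D_def by auto
    have "((\<lambda>t. ?h (t + r)) has_real_derivative s) (at 0)"
      using s(1) by (simp add: scaleR_add_left algebra_simps)
    then have "(?h has_real_derivative s) (at (0 + r))" by (subst DERIV_shift)
    then have "(?h has_real_derivative s) (at r within {0..t})"
      by (simp add: has_field_derivative_at_within)
    moreover have "\<bar>s\<bar> \<le> ?L"
    proof -
      have "\<bar>q * f (y + r *\<^sub>R u)\<bar> \<le> \<bar>q\<bar> * B" using B[OF yr] by (simp add: abs_mult mult_left_mono)
      then show ?thesis using s(2) by linarith
    qed
    ultimately show "\<exists>s. (?h has_real_derivative s) (at r within {0..t}) \<and> \<bar>s\<bar> \<le> ?L" by blast
  qed
  then show False using yv by (simp add: inner_diff_left)
qed

text \<open>The class controls the derivative of the u-component of the gradient along u only, so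
  only the component along the displacement is bounded; Taylor's formula uses no more. Boundary
  points are reached by shrinking both points towards one interior point and passing to the limit, g
  being continuous on \<Omega>.\<close>

lemma W_grad_lipschitz:
  fixes \<Omega> :: "'a::euclidean_space set"
  assumes conv: "convex \<Omega>" and int: "interior \<Omega> \<noteq> {}" and W: "W_grad \<Omega> 0 q f g"
    and B: "\<And>x. x \<in> \<Omega> \<Longrightarrow> \<bar>f x\<bar> \<le> B" and x: "x \<in> \<Omega>" and y: "y \<in> \<Omega>"
  shows "\<bar>(g y - g x) \<bullet> (y - x)\<bar> \<le> (1 + \<bar>q\<bar> * B) * (norm (y - x))\<^sup>2"
proof -
  let ?L = "1 + \<bar>q\<bar> * B"
  have inside: "\<bar>(g y - g x) \<bullet> (y - x)\<bar> \<le> ?L * (norm (y - x))\<^sup>2"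
    if "x \<in> interior \<Omega>" "y \<in> interior \<Omega>" for x y
  proof (cases "x = y")
    case False
    define t where "t = norm (y - x)"
    define u where "u = (y - x) /\<^sub>R t"
    have t: "t > 0" using False by (simp add: t_def)
    have u: "norm u = 1" "y - x = t *\<^sub>R u" using t by (simp_all add: u_def t_def)
    then have yx: "y = x + t *\<^sub>R u" by (simp add: algebra_simps)
    have "\<bar>(g y - g x) \<bullet> u\<bar> \<le> ?L * t"
      using W_grad_interior[OF conv W B u(1), of t x] t that yx by simp
    then have "t * \<bar>(g y - g x) \<bullet> u\<bar> \<le> t * (?L * t)" using t by (intro mult_left_mono) auto
    moreover have "\<bar>(g y - g x) \<bullet> (y - x)\<bar> = t * \<bar>(g y - g x) \<bullet> u\<bar>"
      unfolding u(2) using t by (simp add: abs_mult)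
    ultimately show ?thesis by (simp add: t_def power2_eq_square mult.left_commute)
  qed simp
  obtain z where z: "z \<in> interior \<Omega>" using int by blast
  define s where "s n = inverse (real (Suc n))" for n
  have s: "s \<longlonglongrightarrow> 0" "\<And>n. 0 < s n" "\<And>n. s n \<le> 1"
    unfolding s_def using LIMSEQ_inverse_real_of_nat by (auto simp: field_simps)
  define X where "X v n = v - s n *\<^sub>R (v - z)" for v n
  have Xin: "X v n \<in> interior \<Omega>" if "v \<in> \<Omega>" for v n
    unfolding X_def by (rule mem_interior_convex_shrink[OF conv z that s(2,3)])
  have Xlim: "X v \<longlonglongrightarrow> v" for v
  proof -
    have "(\<lambda>n. v - s n *\<^sub>R (v - z)) \<longlonglongrightarrow> v - 0 *\<^sub>R (v - z)" by (intro tendsto_intros s)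
    then show ?thesis by (simp add: X_def[abs_def])
  qed
  have cg: "continuous_on \<Omega> g" using W by (simp add: W_grad_def)
  have glim: "(\<lambda>n. g (X v n)) \<longlonglongrightarrow> g v" if v: "v \<in> \<Omega>" for v
  proof (rule continuous_on_tendsto_compose[OF cg Xlim v])
    show "\<forall>\<^sub>F n in sequentially. X v n \<in> \<Omega>"
      using Xin[OF v] interior_subset by (intro always_eventually) blast
  qed
  show ?thesis
  proof (rule LIMSEQ_le)
    show "(\<lambda>n. \<bar>(g (X y n) - g (X x n)) \<bullet> (X y n - X x n)\<bar>) \<longlonglongrightarrow> \<bar>(g y - g x) \<bullet> (y - x)\<bar>"
      by (intro tendsto_intros glim x y Xlim)
    show "(\<lambda>n. ?L * (norm (X y n - X x n))\<^sup>2) \<longlonglongrightarrow> ?L * (norm (y - x))\<^sup>2"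
      by (intro tendsto_intros Xlim)
  qed (use inside[OF Xin[OF x] Xin[OF y]] in blast)
qed

section \<open>Derivatives along segments and the Taylor estimate\<close>

lemma has_derivative_on_segment:
  fixes f :: "'a::real_normed_vector \<Rightarrow> 'b::real_normed_vector"
  assumes conv: "convex S" and x: "x \<in> S" and y: "y \<in> S" and t: "t \<in> {0..1}"
    and der: "(f has_derivative A) (at (x + t *\<^sub>R (y - x)) within S)"
  shows "((\<lambda>t. f (x + t *\<^sub>R (y - x))) has_vector_derivative A (y - x)) (at t within {0..1})"
proof -
  have "(\<lambda>t. x + t *\<^sub>R (y - x)) ` {0..1} \<subseteq> S"
  proof clarify
    fix r :: real assume "r \<in> {0..1}"
    then have "(1 - r) *\<^sub>R x + r *\<^sub>R y \<in> S" using conv x y by (simp add: convex_alt)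
    then show "x + r *\<^sub>R (y - x) \<in> S" by (simp add: algebra_simps)
  qed
  then have "(f has_derivative A) (at (x + t *\<^sub>R (y - x)) within (\<lambda>t. x + t *\<^sub>R (y - x)) ` {0..1})"
    using der has_derivative_subset by blast
  moreover have "((\<lambda>t. x + t *\<^sub>R (y - x)) has_derivative (\<lambda>r. r *\<^sub>R (y - x))) (at t within {0..1})"
    by (auto intro!: derivative_eq_intros)
  ultimately have "((\<lambda>t. f (x + t *\<^sub>R (y - x))) has_derivative (\<lambda>r. A (r *\<^sub>R (y - x)))) (at t within {0..1})"
    using has_derivative_in_compose by blast
  moreover have "A (r *\<^sub>R (y - x)) = r *\<^sub>R A (y - x)" for r
    using der has_derivative_linear linear_cmul by blast
  ultimately show ?thesis by (simp add: has_vector_derivative_def)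
qed

text \<open>A derivative within a set need not be unique as a linear map if the set is thin. The
  one-sided derivative at the start of the segment from x to y still determines its value at y -
  x.\<close>

lemma has_derivative_within_convex_unique:
  fixes f :: "'a::real_normed_vector \<Rightarrow> 'b::real_normed_vector"
  assumes "convex S" "x \<in> S" "y \<in> S"
    and "(f has_derivative A) (at x within S)" "(f has_derivative A') (at x within S)"
  shows "A (y - x) = A' (y - x)"
proof -
  have "((\<lambda>t. f (x + t *\<^sub>R (y - x))) has_vector_derivative A (y - x)) (at 0 within {0..1})"
    "((\<lambda>t. f (x + t *\<^sub>R (y - x))) has_vector_derivative A' (y - x)) (at 0 within {0..1})"
    using assms by (auto intro!: has_derivative_on_segment)
  moreover have "at (0::real) within {0..1} \<noteq> bot"
    by (simp add: at_within_Icc_at_right)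
  ultimately show ?thesis using vector_derivative_unique_within by blast
qed

text \<open>The factor 1/2 is that of integrating a derivative bounded by a multiple of t over the
  unit interval. The constant keeps the bound \<open>B\<close> on |f| visible, since
  \<open>B\<close> will later be the unknown maximum of |f|.\<close>

lemma W_grad_taylor:
  fixes \<Omega> :: "'a::euclidean_space set"
  assumes conv: "convex \<Omega>" and int: "interior \<Omega> \<noteq> {}" and W: "W_grad \<Omega> 0 q f g"
    and B: "\<And>x. x \<in> \<Omega> \<Longrightarrow> \<bar>f x\<bar> \<le> B" and x: "x \<in> \<Omega>" and y: "y \<in> \<Omega>"
  shows "\<bar>f y - f x - g x \<bullet> (y - x)\<bar> \<le> (1 + \<bar>q\<bar> * B) / 2 * (norm (y - x))\<^sup>2"
proof -
  define v where "v = y - x"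
  define \<Lambda> where "\<Lambda> = (1 + \<bar>q\<bar> * B) * (norm v)\<^sup>2"
  define \<phi> where "\<phi> t = f (x + t *\<^sub>R v)" for t
  have seg: "x + t *\<^sub>R v \<in> \<Omega>" if "t \<in> {0..1}" for t
  proof -
    have "(1 - t) *\<^sub>R x + t *\<^sub>R y \<in> \<Omega>" using conv x y that by (simp add: convex_alt)
    then show ?thesis by (simp add: algebra_simps v_def)
  qed
  have der: "(\<phi> has_real_derivative g (x + t *\<^sub>R v) \<bullet> v) (at t within {0..1})" if t: "t \<in> {0..1}" for t
  proof -
    have "(f has_derivative (\<lambda>h. g (x + t *\<^sub>R v) \<bullet> h)) (at (x + t *\<^sub>R v) within \<Omega>)"
      using W seg[OF t] by (simp add: W_grad_def)
    then show ?thesis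
      using has_derivative_on_segment[OF conv x y t] 
      unfolding \<phi>_def v_def has_real_derivative_iff_has_vector_derivative by blast
  qed
  have dbound: "\<bar>g (x + t *\<^sub>R v) \<bullet> v - g x \<bullet> v\<bar> \<le> \<Lambda> * t" if t: "0 < t" "t < 1" for t
  proof -
    have "\<bar>(g (x + t *\<^sub>R v) - g x) \<bullet> (x + t *\<^sub>R v - x)\<bar> \<le> (1 + \<bar>q\<bar> * B) * (norm (x + t *\<^sub>R v - x))\<^sup>2"
      using t by (intro W_grad_lipschitz[OF conv int W B x seg]) auto
    then have "t * \<bar>g (x + t *\<^sub>R v) \<bullet> v - g x \<bullet> v\<bar> \<le> t * (\<Lambda> * t)"
      using t by (simp add: abs_mult \<Lambda>_def power_mult_distrib power2_eq_square mult_ac flip: inner_diff_left)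
    then show ?thesis using t by simp
  qed
  have cont: "continuous_on {0..1} \<phi>"
    using der by (meson DERIV_continuous_on)
  have upper: "\<sigma> * (\<phi> 1 - \<phi> 0 - g x \<bullet> v) \<le> \<Lambda> / 2" if \<sigma>: "\<bar>\<sigma>\<bar> = 1" for \<sigma> :: real
  proof -
    \<comment> \<open>Integration is replaced by monotonicity: \<open>E\<close> has a nonnegative
      derivative on the open interval, and \<sigma> = 1 and \<sigma> = -1 give the two halves of the
      absolute value.\<close>
    define E where "E t = \<Lambda> * t\<^sup>2 / 2 - \<sigma> * (\<phi> t - t * (g x \<bullet> v))" for t
    have "E 0 \<le> E 1"
    proof (rule DERIV_nonneg_imp_increasing_open[where f=E and a=0 and b=1])
      show "continuous_on {0..1} E" unfolding E_def by (auto intro!: continuous_intros cont)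
      fix t :: real assume t: "0 < t" "t < 1"
      have d: "(\<phi> has_real_derivative g (x + t *\<^sub>R v) \<bullet> v) (at t)"
        using der[of t] t by (simp add: at_within_Icc_at)
      have "(E has_real_derivative \<Lambda> * t - \<sigma> * (g (x + t *\<^sub>R v) \<bullet> v - g x \<bullet> v)) (at t)"
        unfolding E_def by (auto intro!: derivative_eq_intros d)
      moreover have "\<sigma> * (g (x + t *\<^sub>R v) \<bullet> v - g x \<bullet> v) \<le> \<Lambda> * t"
        using dbound[OF t] \<sigma> abs_ge_self[of "\<sigma> * (g (x + t *\<^sub>R v) \<bullet> v - g x \<bullet> v)"] by (simp add: abs_mult)
      ultimately show "\<exists>y. (E has_real_derivative y) (at t) \<and> 0 \<le> y" by force
    qed simp
    then show ?thesis by (simp add: E_def algebra_simps)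
  qed
  have "\<bar>\<phi> 1 - \<phi> 0 - g x \<bullet> v\<bar> \<le> \<Lambda> / 2"
    using upper[of 1] upper[of "-1"] unfolding abs_le_iff by (simp del: minus_diff_eq)
  then show ?thesis by (simp add: \<phi>_def v_def \<Lambda>_def)
qed

section \<open>Upper bound for the recovery error\<close>

lemma abs_half_diff_le: "\<bar>(a - b) / 2\<bar> \<le> (\<bar>a\<bar> + \<bar>b\<bar>) / 2" for a b :: real
  using abs_triangle_ineq4[of a b] by simp

lemma abs_cont_on_half_diff:
  assumes "abs_cont_on S h1" "abs_cont_on S h2"
  shows "abs_cont_on S (\<lambda>t. (h1 t - h2 t) / 2)"
  unfolding abs_cont_on_def
proof (intro allI impI)
  fix e :: real assume e: "e > 0"
  obtain d1 where d1: "d1 > 0" "\<forall>(n::nat) (a::nat \<Rightarrow> real) b.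
        (\<forall>i<n. a i \<le> b i \<and> {a i..b i} \<subseteq> S) \<and>
        (\<forall>i<n. \<forall>j<n. i \<noteq> j \<longrightarrow> b i \<le> a j \<or> b j \<le> a i) \<and>
        (\<Sum>i<n. b i - a i) < d1 \<longrightarrow> (\<Sum>i<n. \<bar>h1 (b i) - h1 (a i)\<bar>) < e"
    using assms(1) e unfolding abs_cont_on_def by (elim allE[of _ e] impE exE conjE) auto
  obtain d2 where d2: "d2 > 0" "\<forall>(n::nat) (a::nat \<Rightarrow> real) b.
        (\<forall>i<n. a i \<le> b i \<and> {a i..b i} \<subseteq> S) \<and>
        (\<forall>i<n. \<forall>j<n. i \<noteq> j \<longrightarrow> b i \<le> a j \<or> b j \<le> a i) \<and>
        (\<Sum>i<n. b i - a i) < d2 \<longrightarrow> (\<Sum>i<n. \<bar>h2 (b i) - h2 (a i)\<bar>) < e"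
    using assms(2) e unfolding abs_cont_on_def by (elim allE[of _ e] impE exE conjE) auto
  have "(\<Sum>i<n. \<bar>(h1 (b i) - h2 (b i)) / 2 - (h1 (a i) - h2 (a i)) / 2\<bar>) < e"
    if ab: "\<forall>i<n. a i \<le> b i \<and> {a i..b i} \<subseteq> S"
      "\<forall>i<n. \<forall>j<n. i \<noteq> j \<longrightarrow> b i \<le> a j \<or> b j \<le> a i" "(\<Sum>i<n. b i - a i) < min d1 d2"
    for n :: nat and a b
  proof -
    have "(\<Sum>i<n. \<bar>h1 (b i) - h1 (a i)\<bar>) < e" "(\<Sum>i<n. \<bar>h2 (b i) - h2 (a i)\<bar>) < e"
      using d1(2)[rule_format, of n a b] d2(2)[rule_format, of n a b] ab by auto
    moreover have "(\<Sum>i<n. \<bar>(h1 (b i) - h2 (b i)) / 2 - (h1 (a i) - h2 (a i)) / 2\<bar>)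
        \<le> (\<Sum>i<n. (\<bar>h1 (b i) - h1 (a i)\<bar> + \<bar>h2 (b i) - h2 (a i)\<bar>) / 2)"
    proof (rule sum_mono)
      fix i
      have "(h1 (b i) - h2 (b i)) / 2 - (h1 (a i) - h2 (a i)) / 2
          = ((h1 (b i) - h1 (a i)) - (h2 (b i) - h2 (a i))) / 2" by (simp add: field_simps)
      then show "\<bar>(h1 (b i) - h2 (b i)) / 2 - (h1 (a i) - h2 (a i)) / 2\<bar>
          \<le> (\<bar>h1 (b i) - h1 (a i)\<bar> + \<bar>h2 (b i) - h2 (a i)\<bar>) / 2"
        by (simp only: abs_half_diff_le)
    qed
    ultimately show ?thesis
      by (simp add: sum.distrib flip: sum_divide_distrib)
  qed
  then show "\<exists>\<delta>>0. \<forall>(n::nat) a b. (\<forall>i<n. a i \<le> b i \<and> {a i..b i} \<subseteq> S) \<and>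
        (\<forall>i<n. \<forall>j<n. i \<noteq> j \<longrightarrow> b i \<le> a j \<or> b j \<le> a i) \<and> (\<Sum>i<n. b i - a i) < \<delta>
        \<longrightarrow> (\<Sum>i<n. \<bar>(h1 (b i) - h2 (b i)) / 2 - (h1 (a i) - h2 (a i)) / 2\<bar>) < e"
    using d1(1) d2(1) by (intro exI[of _ "min d1 d2"]) auto
qed

text \<open>The class is convex and symmetric about 0. Two functions with the same data thus yield a
  member of the class with zero data, and a bound r for such members puts any two functions of a
  fibre within distance 2 r.\<close>

lemma W_grad_half_diff:
  assumes 1: "W_grad \<Omega> p q f1 g1" and 2: "W_grad \<Omega> p q f2 g2"
  shows "W_grad \<Omega> p q (\<lambda>x. (f1 x - f2 x) / 2) (\<lambda>x. (g1 x - g2 x) /\<^sub>R 2)"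
  unfolding W_grad_def
proof (intro conjI ballI allI impI)
  fix x assume x: "x \<in> \<Omega>"
  have "(f1 has_derivative (\<lambda>h. g1 x \<bullet> h)) (at x within \<Omega>)"
    "(f2 has_derivative (\<lambda>h. g2 x \<bullet> h)) (at x within \<Omega>)"
    using 1 2 x by (auto simp: W_grad_def)
  then have "((\<lambda>x. (f1 x - f2 x) / 2) has_derivative (\<lambda>h. (g1 x \<bullet> h - g2 x \<bullet> h) / 2)) (at x within \<Omega>)"
    by (auto intro!: derivative_eq_intros)
  moreover have "(\<lambda>h. (g1 x \<bullet> h - g2 x \<bullet> h) / 2) = (\<bullet>) ((g1 x - g2 x) /\<^sub>R 2)"
    by (rule ext) (simp add: inner_diff_left field_simps)
  ultimately show "((\<lambda>x. (f1 x - f2 x) / 2) has_derivative (\<bullet>) ((g1 x - g2 x) /\<^sub>R 2)) (at x within \<Omega>)"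
    by simp
next
  show "continuous_on \<Omega> (\<lambda>x. (g1 x - g2 x) /\<^sub>R 2)"
    using 1 2 by (auto simp: W_grad_def intro!: continuous_intros)
next
  fix u :: 'a assume u: "norm u = 1"
  have eq: "((g1 x - g2 x) /\<^sub>R 2) \<bullet> u = (g1 x \<bullet> u - g2 x \<bullet> u) / 2" for x
    by (simp add: inner_diff_left field_simps)
  have "AE x in lebesgue. x \<in> interior \<Omega> \<longrightarrow>
             loc_abs_cont_on {t. x + t *\<^sub>R u \<in> interior \<Omega>} (\<lambda>t. g1 (x + t *\<^sub>R u) \<bullet> u)"
    "AE x in lebesgue. x \<in> interior \<Omega> \<longrightarrow>
             loc_abs_cont_on {t. x + t *\<^sub>R u \<in> interior \<Omega>} (\<lambda>t. g2 (x + t *\<^sub>R u) \<bullet> u)"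
    using 1 2 u by (auto simp: W_grad_def)
  then show "AE x in lebesgue. x \<in> interior \<Omega> \<longrightarrow>
      loc_abs_cont_on {t. x + t *\<^sub>R u \<in> interior \<Omega>} (\<lambda>t. ((g1 (x + t *\<^sub>R u) - g2 (x + t *\<^sub>R u)) /\<^sub>R 2) \<bullet> u)"
    unfolding eq by eventually_elim (simp add: loc_abs_cont_on_def abs_cont_on_half_diff)
  have "AE x in lebesgue. x \<in> \<Omega> \<longrightarrow> (\<exists>s. ((\<lambda>t. g1 (x + t *\<^sub>R u) \<bullet> u) has_real_derivative s) (at 0) \<and>
                  \<bar>s + p * (g1 x \<bullet> u) + q * f1 x\<bar> \<le> 1)"
    "AE x in lebesgue. x \<in> \<Omega> \<longrightarrow> (\<exists>s. ((\<lambda>t. g2 (x + t *\<^sub>R u) \<bullet> u) has_real_derivative s) (at 0) \<and>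
                  \<bar>s + p * (g2 x \<bullet> u) + q * f2 x\<bar> \<le> 1)"
    using 1 2 u by (auto simp: W_grad_def)
  then show "AE x in lebesgue. x \<in> \<Omega> \<longrightarrow>
      (\<exists>s. ((\<lambda>t. ((g1 (x + t *\<^sub>R u) - g2 (x + t *\<^sub>R u)) /\<^sub>R 2) \<bullet> u) has_real_derivative s) (at 0) \<and>
           \<bar>s + p * (((g1 x - g2 x) /\<^sub>R 2) \<bullet> u) + q * ((f1 x - f2 x) / 2)\<bar> \<le> 1)"
    unfolding eq
  proof eventually_elim
    case (elim x)
    show ?case
    proof
      assume "x \<in> \<Omega>"
      then obtain s1 s2 where s: "((\<lambda>t. g1 (x + t *\<^sub>R u) \<bullet> u) has_real_derivative s1) (at 0)"
        "\<bar>s1 + p * (g1 x \<bullet> u) + q * f1 x\<bar> \<le> 1" "((\<lambda>t. g2 (x + t *\<^sub>R u) \<bullet> u) has_real_derivative s2) (at 0)"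
        "\<bar>s2 + p * (g2 x \<bullet> u) + q * f2 x\<bar> \<le> 1" using elim by blast
      have "((\<lambda>t. (g1 (x + t *\<^sub>R u) \<bullet> u - g2 (x + t *\<^sub>R u) \<bullet> u) / 2) has_real_derivative (s1 - s2) / 2) (at 0)"
        by (intro DERIV_cdivide DERIV_diff s)
      moreover have "(s1 - s2) / 2 + p * ((g1 x \<bullet> u - g2 x \<bullet> u) / 2) + q * ((f1 x - f2 x) / 2)
         = ((s1 + p * (g1 x \<bullet> u) + q * f1 x) - (s2 + p * (g2 x \<bullet> u) + q * f2 x)) / 2"
        by (simp add: field_simps)
      moreover have "\<bar>((s1 + p * (g1 x \<bullet> u) + q * f1 x) - (s2 + p * (g2 x \<bullet> u) + q * f2 x)) / 2\<bar> \<le> 1"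
        by (rule order_trans[OF abs_half_diff_le]) (use s(2,4) in simp)
      ultimately show "\<exists>s. ((\<lambda>t. (g1 (x + t *\<^sub>R u) \<bullet> u - g2 (x + t *\<^sub>R u) \<bullet> u) / 2) has_real_derivative s) (at 0)
          \<and> \<bar>s + p * ((g1 x \<bullet> u - g2 x \<bullet> u) / 2) + q * ((f1 x - f2 x) / 2)\<bar> \<le> 1"
        by (intro exI[of _ "(s1 - s2) / 2"] conjI) (assumption, simp only:)
    qed
  qed
qed

lemma W_grad_continuous_on: "W_grad \<Omega> p q f g \<Longrightarrow> continuous_on \<Omega> f"
  unfolding W_grad_def continuous_on_eq_continuous_within by (blast intro: has_derivative_continuous)

text \<open>At an interior maximum of \<open>\<bar>k\<bar>\<close> the gradient vanishes, as it does at the nearest node: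
  two Taylor expansions meeting at the midpoint give a quarter of the squared distance instead of a half.
  At a boundary maximum only the expansion at the node is available, so nodes must be closer there.\<close>

lemma W_zero_info_bound:
  fixes \<Omega> :: "'a::euclidean_space set"
  assumes conv: "convex \<Omega>" and comp: "compact \<Omega>" and int: "interior \<Omega> \<noteq> {}" and W: "W_grad \<Omega> 0 q k g"
    and \<xi>: "\<xi> \<subseteq> \<Omega>" and zero: "\<And>z. z \<in> \<xi> \<Longrightarrow> k z = 0"
    and dzero: "\<And>z. z \<in> \<xi> \<Longrightarrow> (k has_derivative (\<lambda>h. 0)) (at z within \<Omega>)"
    and net: "\<And>x. x \<in> \<Omega> \<Longrightarrow> \<exists>z\<in>\<xi>. dist x z \<le> h"
    and bnet: "\<And>x. x \<in> frontier \<Omega> \<Longrightarrow> \<exists>z\<in>\<xi>. dist x z \<le> h / 2"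
    and h: "\<bar>q\<bar> * (h\<^sup>2 / 4) < 1" and x: "x \<in> \<Omega>"
  shows "\<bar>k x\<bar> \<le> (h\<^sup>2 / 4) / (1 - \<bar>q\<bar> * (h\<^sup>2 / 4))"
proof -
  have "continuous_on \<Omega> (\<lambda>x. \<bar>k x\<bar>)" by (intro continuous_intros W_grad_continuous_on[OF W])
  then obtain m where m: "m \<in> \<Omega>" "\<And>y. y \<in> \<Omega> \<Longrightarrow> \<bar>k y\<bar> \<le> \<bar>k m\<bar>"
    using continuous_attains_sup[OF comp, of "\<lambda>x. \<bar>k x\<bar>"] x by blast
  \<comment> \<open>Taking the attained maximum as the bound in the Taylor estimate makes the final
    inequality linear in \<open>k m\<close>; it is solved at the end, where smallness of |q| h^2/4
    keeps the coefficient positive.\<close>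
  define L where "L = 1 + \<bar>q\<bar> * \<bar>k m\<bar>"
  have L: "L > 0" by (simp add: L_def add_pos_nonneg)
  have taylor: "\<bar>k y - k x - g x \<bullet> (y - x)\<bar> \<le> L / 2 * (norm (y - x))\<^sup>2" if "x \<in> \<Omega>" "y \<in> \<Omega>" for x y
    unfolding L_def by (rule W_grad_taylor[OF conv int W m(2) that])
  have node: "\<bar>k y\<bar> \<le> L / 2 * (norm (y - z))\<^sup>2" if z: "z \<in> \<xi>" and y: "y \<in> \<Omega>" for y z
  proof -
    have "(k has_derivative (\<lambda>h. g z \<bullet> h)) (at z within \<Omega>)" using W z \<xi> by (auto simp: W_grad_def)
    then have "g z \<bullet> (y - z) = 0"
      using has_derivative_within_convex_unique[OF conv _ y _ dzero[OF z]] z \<xi> by blast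
    then show ?thesis using taylor[of z y] zero[OF z] z y \<xi> by auto
  qed
  have "\<bar>k m\<bar> \<le> L * (h\<^sup>2 / 4)"
  proof (cases "m \<in> interior \<Omega>")
    case False
    then have "m \<in> frontier \<Omega>" using m(1) by (simp add: frontier_def closure_def)
    \<comment> \<open>One expansion with constant 1/2 stays below h^2/4 as long as the node is
      within h / sqrt 2; the radius h/2 is a convenient choice below that.\<close>
    then obtain z where z: "z \<in> \<xi>" "dist m z \<le> h / 2" using bnet by blast
    have "(norm (m - z))\<^sup>2 \<le> (h / 2)\<^sup>2" using z(2) by (intro power_mono) (auto simp: dist_norm)
    then have "L / 2 * (norm (m - z))\<^sup>2 \<le> L / 2 * (h / 2)\<^sup>2" using L by (intro mult_left_mono) auto
    also have "\<dots> \<le> L * (h\<^sup>2 / 4)" using L by (simp add: power2_eq_square)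
    finally show ?thesis using node[OF z(1) m(1)] by linarith
  next
    case True
    obtain z where z: "z \<in> \<xi>" "dist m z \<le> h" using net m by blast
    have der: "(k has_derivative (\<lambda>h. g m \<bullet> h)) (at m)"
      using W m(1) at_within_interior[OF True] by (auto simp: W_grad_def)
    have "(\<forall>y\<in>interior \<Omega>. k y \<le> k m) \<or> (\<forall>y\<in>interior \<Omega>. k m \<le> k y)"
    proof (cases "k m \<ge> 0")
      case True
      then have "k y \<le> k m" if "y \<in> \<Omega>" for y using m(2)[OF that] by linarith
      then show ?thesis using interior_subset by blast
    next
      case False
      then have "k m \<le> k y" if "y \<in> \<Omega>" for y using m(2)[OF that] by linarith
      then show ?thesis using interior_subset by blast
    qed
    then have "(\<lambda>h. g m \<bullet> h) = (\<lambda>v. 0)"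
      by (rule differential_zero_maxmin[OF True open_interior der])
    then have gm: "g m \<bullet> v = 0" for v by meson
    define c where "c = midpoint m z"
    have c: "c \<in> \<Omega>" using m(1) z(1) \<xi> conv unfolding c_def
      by (meson convex_contains_segment midpoint_in_closed_segment subsetD)
    have nc: "norm (c - z) = norm (m - z) / 2" "norm (c - m) = norm (m - z) / 2"
      using dist_midpoint[of m z] by (simp_all add: c_def dist_norm norm_minus_commute)
    have "\<bar>k c\<bar> \<le> L / 2 * (norm (m - z) / 2)\<^sup>2" using node[OF z(1) c] nc by simp
    moreover have "\<bar>k c - k m\<bar> \<le> L / 2 * (norm (m - z) / 2)\<^sup>2"
      using taylor[OF m(1) c] gm nc by simp
    ultimately have "\<bar>k m\<bar> \<le> 2 * (L / 2 * (norm (m - z) / 2)\<^sup>2)" by linarith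
    also have "\<dots> = L * ((norm (m - z))\<^sup>2 / 4)" by (simp add: power2_eq_square)
    also have "\<dots> \<le> L * (h\<^sup>2 / 4)"
      using z(2) L by (intro mult_left_mono divide_right_mono power_mono) (auto simp: dist_norm)
    finally show ?thesis .
  qed
  then have "\<bar>k m\<bar> * (1 - \<bar>q\<bar> * (h\<^sup>2 / 4)) \<le> h\<^sup>2 / 4" by (simp add: L_def algebra_simps)
  then have "\<bar>k m\<bar> \<le> (h\<^sup>2 / 4) / (1 - \<bar>q\<bar> * (h\<^sup>2 / 4))" using h
    by (subst pos_le_divide_eq) (simp_all only: diff_gt_0_iff_gt)
  then show ?thesis using m(2)[OF x] by linarith
qed

section \<open>Continuity of the centre of a fibre\<close>

lemma lipschitz_on_SUP:
  fixes K :: "('a::metric_space \<Rightarrow> real) set"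
  assumes ne: "K \<noteq> {}" and b: "\<And>k x. \<lbrakk>k \<in> K; x \<in> S\<rbrakk> \<Longrightarrow> \<bar>k x\<bar> \<le> r"
    and lip: "\<And>k. k \<in> K \<Longrightarrow> C-lipschitz_on S k"
  shows "C-lipschitz_on S (\<lambda>x. SUP k\<in>K. k x)"
proof (rule lipschitz_onI)
  show "0 \<le> C" using ne lip lipschitz_on_nonneg by blast
  have bdd: "bdd_above ((\<lambda>k. k x) ` K)" if "x \<in> S" for x
    using b that by (intro bdd_aboveI[of _ r]) (auto simp: abs_le_iff)
  have le: "(SUP k\<in>K. k x) \<le> (SUP k\<in>K. k y) + C * dist x y" if xy: "x \<in> S" "y \<in> S" for x y
  proof (rule cSUP_least[OF ne])
    fix k assume k: "k \<in> K"
    have "dist (k x) (k y) \<le> C * dist x y" by (rule lipschitz_onD[OF lip[OF k] xy])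
    moreover have "k y \<le> (SUP k\<in>K. k y)" by (rule cSUP_upper[OF k bdd[OF xy(2)]])
    ultimately show "k x \<le> (SUP k\<in>K. k y) + C * dist x y" by (simp add: dist_real_def)
  qed
  fix x y assume "x \<in> S" "y \<in> S"
  then show "dist (SUP k\<in>K. k x) (SUP k\<in>K. k y) \<le> C * dist x y"
    using le[of x y] le[of y x] by (simp add: dist_real_def dist_commute abs_le_iff)
qed

text \<open>Equicontinuity is needed because an algorithm must return continuous functions, whereas the centre
  of a fibre is defined by pointwise suprema.\<close>

lemma W_grad_equi_lipschitz:
  fixes \<Omega> :: "'a::euclidean_space set"
  assumes conv: "convex \<Omega>" and comp: "compact \<Omega>" and int: "interior \<Omega> \<noteq> {}"
  shows "\<exists>C\<ge>0. \<forall>f\<in>W_class \<Omega> 0 q. (\<forall>x\<in>\<Omega>. \<bar>f x\<bar> \<le> B) \<longrightarrow> C-lipschitz_on \<Omega> f"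
proof -
  obtain c where "c \<in> interior \<Omega>" using int by blast
  then obtain \<rho> where \<rho>: "\<rho> > 0" "cball c \<rho> \<subseteq> \<Omega>" using mem_interior_cball by blast
  define L where "L = 1 + \<bar>q\<bar> * \<bar>B\<bar>"
  define D where "D = diameter \<Omega>"
  define K where "K = 2 * \<bar>B\<bar> + L / 2 * D\<^sup>2"
  define C where "C = 2 * K / \<rho> + L / 2 * D"
  have D: "norm (y - x) \<le> D" if "x \<in> \<Omega>" "y \<in> \<Omega>" for x y
    using diameter_bounded_bound[OF compact_imp_bounded[OF comp] that(2,1)] by (simp add: D_def dist_norm)
  have L0: "L \<ge> 0" by (simp add: L_def)
  have D0: "D \<ge> 0" by (simp add: D_def diameter_ge_0 compact_imp_bounded[OF comp])
  have C0: "C \<ge> 0" using L0 D0 \<rho>(1) by (simp add: C_def K_def)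
  have "C-lipschitz_on \<Omega> f" if f: "f \<in> W_class \<Omega> 0 q" "\<And>x. x \<in> \<Omega> \<Longrightarrow> \<bar>f x\<bar> \<le> B" for f
  proof -
    obtain g where W: "W_grad \<Omega> 0 q f g" using f(1) W_class_iff by blast
    have fB: "\<bar>f x\<bar> \<le> \<bar>B\<bar>" if "x \<in> \<Omega>" for x using f(2)[OF that] by linarith
    have taylor: "\<bar>f y - f x - g x \<bullet> (y - x)\<bar> \<le> L / 2 * (norm (y - x))\<^sup>2" if "x \<in> \<Omega>" "y \<in> \<Omega>" for x y
      unfolding L_def by (rule W_grad_taylor[OF conv int W fB that])
    have gK: "\<bar>g x \<bullet> (y - x)\<bar> \<le> K" if xy: "x \<in> \<Omega>" "y \<in> \<Omega>" for x y
    proof -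
      have "L / 2 * (norm (y - x))\<^sup>2 \<le> L / 2 * D\<^sup>2"
        using D[OF xy] L0 by (intro mult_left_mono power_mono) auto
      then show ?thesis using taylor[OF xy] fB[OF xy(1)] fB[OF xy(2)] unfolding K_def by linarith
    qed
    have gn: "norm (g x) \<le> 2 * K / \<rho>" if x: "x \<in> \<Omega>" for x
    proof (cases "g x = 0")
      case True
      then show ?thesis using L0 \<rho>(1) by (simp add: K_def)
    next
      case False
      \<comment> \<open>Taylor bounds \<open>g x\<close> only against directions from x to points of
        \<Omega>, which at a boundary point fill no full neighbourhood. Comparing the centre c of an
        inscribed ball with its boundary point in the direction of \<open>g x\<close> recovers the
        norm.\<close>
      define y where "y = c + (\<rho> / norm (g x)) *\<^sub>R g x"
      have "y \<in> cball c \<rho>" using False \<rho>(1) by (simp add: y_def dist_norm)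
      moreover have "c \<in> cball c \<rho>" using \<rho>(1) by simp
      ultimately have "\<bar>g x \<bullet> (y - x)\<bar> \<le> K" "\<bar>g x \<bullet> (c - x)\<bar> \<le> K"
        using gK[OF x] \<rho>(2) by blast+
      moreover have "g x \<bullet> (y - x) = g x \<bullet> (c - x) + \<rho> * norm (g x)"
        using False by (simp add: y_def inner_diff_right inner_add_right dot_square_norm power2_eq_square)
      ultimately have "\<rho> * norm (g x) \<le> 2 * K" by linarith
      then show ?thesis using \<rho>(1) by (simp add: field_simps)
    qed
    show ?thesis
    proof (rule lipschitz_onI[OF _ C0])
      fix x y assume xy: "x \<in> \<Omega>" "y \<in> \<Omega>"
      have "\<bar>f y - f x\<bar> \<le> \<bar>g x \<bullet> (y - x)\<bar> + L / 2 * (norm (y - x))\<^sup>2" using taylor[OF xy] by linarith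
      also have "\<bar>g x \<bullet> (y - x)\<bar> \<le> norm (g x) * norm (y - x)" by (rule Cauchy_Schwarz_ineq2)
      also have "\<dots> \<le> 2 * K / \<rho> * norm (y - x)" using gn[OF xy(1)] by (intro mult_right_mono) auto
      also have "L / 2 * (norm (y - x))\<^sup>2 \<le> L / 2 * (D * norm (y - x))"
        using D[OF xy] L0 unfolding power2_eq_square by (intro mult_left_mono mult_right_mono) auto
      finally show "dist (f x) (f y) \<le> C * dist x y"
        by (simp add: C_def dist_real_def dist_norm norm_minus_commute abs_minus_commute algebra_simps)
    qed
  qed
  then show ?thesis using C0 by blast
qed

lemma recovery_error_le:
  fixes \<Omega> :: "'a::euclidean_space set"
  assumes conv: "convex \<Omega>" and comp: "compact \<Omega>" and int: "interior \<Omega> \<noteq> {}"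
    and \<xi>: "\<xi> \<subseteq> \<Omega>" and net: "\<And>x. x \<in> \<Omega> \<Longrightarrow> \<exists>z\<in>\<xi>. dist x z \<le> h"
    and bnet: "\<And>x. x \<in> frontier \<Omega> \<Longrightarrow> \<exists>z\<in>\<xi>. dist x z \<le> h / 2"
    and h: "\<bar>q\<bar> * (h\<^sup>2 / 4) < 1"
  shows "recovery_error \<Omega> 0 q \<xi> \<le> ereal ((h\<^sup>2 / 4) / (1 - \<bar>q\<bar> * (h\<^sup>2 / 4)))"
proof -
  define r where "r = (h\<^sup>2 / 4) / (1 - \<bar>q\<bar> * (h\<^sup>2 / 4))"
  define F where "F I = {f \<in> W_class \<Omega> 0 q. info \<Omega> \<xi> f = I}" for I
  have gradW: "(f has_derivative (\<lambda>v. grad_on \<Omega> f z \<bullet> v)) (at z within \<Omega>)"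
    if "f \<in> W_class \<Omega> 0 q" "z \<in> \<Omega>" for f z
    unfolding grad_on_def by (rule someI_ex) (use that in \<open>auto simp: W_class_iff W_grad_def\<close>)
  have half: "(\<lambda>x. (f1 x - f2 x) / 2) \<in> W_class \<Omega> 0 q" if "f1 \<in> F I" "f2 \<in> F I" for f1 f2 I
    using that W_grad_half_diff unfolding F_def W_class_iff by blast
  have diff: "\<bar>(f1 x - f2 x) / 2\<bar> \<le> r" if f: "f1 \<in> F I" "f2 \<in> F I" and x: "x \<in> \<Omega>" for f1 f2 I x
  proof -
    obtain g where W: "W_grad \<Omega> 0 q (\<lambda>x. (f1 x - f2 x) / 2) g" using half[OF f] W_class_iff by blast
    have info_eq: "f1 z = f2 z \<and> grad_on \<Omega> f1 z = grad_on \<Omega> f2 z" if z: "z \<in> \<xi>" for z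
    proof -
      have "info \<Omega> \<xi> f1 z = info \<Omega> \<xi> f2 z" using f by (simp add: F_def)
      then show ?thesis using z by (simp add: info_def)
    qed
    have der0: "((\<lambda>x. (f1 x - f2 x) / 2) has_derivative (\<lambda>h. 0)) (at z within \<Omega>)" if z: "z \<in> \<xi>" for z
    proof -
      have "(f1 has_derivative (\<lambda>v. grad_on \<Omega> f1 z \<bullet> v)) (at z within \<Omega>)"
        "(f2 has_derivative (\<lambda>v. grad_on \<Omega> f1 z \<bullet> v)) (at z within \<Omega>)"
        using gradW[of f1 z] gradW[of f2 z] f z \<xi> info_eq[OF z] by (auto simp: F_def)
      then show ?thesis by (auto intro!: derivative_eq_intros)
    qed
    show ?thesis unfolding r_def
      by (rule W_zero_info_bound[OF conv comp int W \<xi> _ der0 net bnet h x]) (use info_eq in auto)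
  qed
  \<comment> \<open>The class need not be uniformly bounded (for q = 0 it contains all affine
    functions), so its members need not share a Lipschitz constant. Half differences to a reference
    element of the fibre lie in the class and are bounded by r, as the equi-Lipschitz bound
    requires.\<close>
  define f0 where "f0 I = (SOME f. f \<in> F I)" for I
  have f0: "f0 I \<in> F I" if "F I \<noteq> {}" for I
    unfolding f0_def using that by (simp add: some_in_eq)
  define K where "K I = (\<lambda>f x. (f x - f0 I x) / 2) ` F I" for I
  define K' where "K' I = (\<lambda>k x. - k x) ` K I" for I
  \<comment> \<open>With f = f0 + 2 k on the fibre, this is the mean of the supremum and the infimum
    of f: the infimum of k enters as minus the supremum of -k. For an empty fibre 0 is a
    default.\<close>
  define \<phi> where "\<phi> I x = (if F I = {} then 0 else f0 I x + (SUP k\<in>K I. k x) - (SUP k\<in>K' I. k x))" for I x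
  obtain C where "C \<ge> 0" and C: "\<And>f. \<lbrakk>f \<in> W_class \<Omega> 0 q; \<forall>x\<in>\<Omega>. \<bar>f x\<bar> \<le> r\<rbrakk> \<Longrightarrow> C-lipschitz_on \<Omega> f"
    using W_grad_equi_lipschitz[OF conv comp int, of q r] by blast
  have Kb: "\<bar>k x\<bar> \<le> r" if "k \<in> K I" "x \<in> \<Omega>" "F I \<noteq> {}" for k I x
    using that(1,2) f0[OF that(3)] diff[of _ I "f0 I" x] by (auto simp: K_def)
  have K'b: "\<bar>k x\<bar> \<le> r" if "k \<in> K' I" "x \<in> \<Omega>" "F I \<noteq> {}" for k I x
    using that(1) Kb[OF _ that(2,3)] by (auto simp: K'_def)
  have Klip: "C-lipschitz_on \<Omega> k" if k: "k \<in> K I" and ne: "F I \<noteq> {}" for k I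
    using k half[OF _ f0[OF ne]] Kb[OF k _ ne] by (intro C) (auto simp: K_def)
  have K'lip: "C-lipschitz_on \<Omega> k" if k: "k \<in> K' I" and ne: "F I \<noteq> {}" for k I
    using k Klip ne unfolding K'_def by (auto intro: lipschitz_on_minus)
  have cont: "continuous_on \<Omega> (\<phi> I)" for I
  proof (cases "F I = {}")
    case True
    then show ?thesis by (simp add: \<phi>_def[abs_def])
  next
    case False
    have ne: "K I \<noteq> {}" "K' I \<noteq> {}" using False by (auto simp: K_def K'_def)
    have "f0 I \<in> W_class \<Omega> 0 q" using f0[OF False] by (simp add: F_def)
    then have "continuous_on \<Omega> (f0 I)" using W_grad_continuous_on W_class_iff by blast
    moreover have "continuous_on \<Omega> (\<lambda>x. SUP k\<in>K I. k x)"
      by (rule lipschitz_on_continuous_on[where L=C, OF lipschitz_on_SUP[OF ne(1)]]) (use Kb[of _ I] Klip[of _ I] False in auto)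
    moreover have "continuous_on \<Omega> (\<lambda>x. SUP k\<in>K' I. k x)"
      by (rule lipschitz_on_continuous_on[where L=C, OF lipschitz_on_SUP[OF ne(2)]]) (use K'b[of _ I] K'lip[of _ I] False in auto)
    ultimately show ?thesis using False by (auto simp: \<phi>_def[abs_def] intro!: continuous_intros)
  qed
  have err: "\<bar>f x - \<phi> (info \<Omega> \<xi> f) x\<bar> \<le> r" if f: "f \<in> W_class \<Omega> 0 q" and x: "x \<in> \<Omega>" for f x
  proof -
    define I where "I = info \<Omega> \<xi> f"
    have fI: "f \<in> F I" using f by (simp add: F_def I_def)
    then have ne: "F I \<noteq> {}" by blast
    have neK: "K I \<noteq> {}" "K' I \<noteq> {}" using ne by (auto simp: K_def K'_def)
    let ?k = "(f x - f0 I x) / 2" and ?S = "SUP k\<in>K I. k x" and ?S' = "SUP k\<in>K' I. k x"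
    have bdd: "bdd_above ((\<lambda>k. k x) ` K I)" "bdd_above ((\<lambda>k. k x) ` K' I)"
      using Kb[OF _ x ne] K'b[OF _ x ne] by (auto intro!: bdd_aboveI[of _ r] simp: abs_le_iff)
    have "(\<lambda>x. (f x - f0 I x) / 2) \<in> K I" using fI by (auto simp: K_def)
    from cSUP_upper[OF this bdd(1)] have 1: "?k \<le> ?S" by simp
    have "(\<lambda>x. - ((f x - f0 I x) / 2)) \<in> K' I" using fI by (auto simp: K'_def K_def)
    from cSUP_upper[OF this bdd(2)] have 2: "- ?k \<le> ?S'" by simp
    have 3: "?S \<le> ?k + r"
    proof (rule cSUP_least[OF neK(1)])
      fix k assume "k \<in> K I"
      then obtain f' where "f' \<in> F I" "k = (\<lambda>x. (f' x - f0 I x) / 2)" by (auto simp: K_def)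
      then show "k x \<le> ?k + r" using diff[OF _ fI x, of f'] by (simp add: abs_le_iff field_simps)
    qed
    have 4: "?S' \<le> - ?k + r"
    proof (rule cSUP_least[OF neK(2)])
      fix k assume "k \<in> K' I"
      then obtain f' where "f' \<in> F I" "k = (\<lambda>x. - ((f' x - f0 I x) / 2))" by (auto simp: K'_def K_def)
      then show "k x \<le> - ?k + r" using diff[OF _ fI x, of f'] by (simp add: abs_le_iff field_simps)
    qed
    have "\<phi> I x = f0 I x + ?S - ?S'" using ne by (simp add: \<phi>_def)
    then have "f x - \<phi> I x = 2 * ?k - ?S + ?S'" by (simp add: field_simps)
    then show ?thesis using 1 2 3 4 unfolding I_def[symmetric] by (intro abs_leI) linarith+
  qed
  have "recovery_error \<Omega> 0 q \<xi> \<le> (SUP f \<in> W_class \<Omega> 0 q. SUP x \<in> \<Omega>. ereal \<bar>f x - \<phi> (info \<Omega> \<xi> f) x\<bar>)"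
    unfolding recovery_error_def by (rule INF_lower) (use cont in auto)
  also have "\<dots> \<le> ereal r" by (intro SUP_least) (use err in simp)
  finally show ?thesis by (simp add: r_def)
qed

section \<open>Lower bound for the recovery error\<close>

text \<open>The nearest-point map of the ball, in a closed form from which the derivatives of the
  bump can be read off; its identification with \<open>closest_point\<close> gives the Lipschitz
  constant 1.\<close>

definition ball_proj :: "real \<Rightarrow> 'a::euclidean_space \<Rightarrow> 'a" where
  "ball_proj \<rho> y = (if norm y \<le> \<rho> then y else (\<rho> / norm y) *\<^sub>R y)"

lemma ball_proj_eq_closest_point:
  assumes \<rho>: "\<rho> > 0"
  shows "ball_proj \<rho> y = closest_point (cball 0 \<rho>) y"
proof (rule closest_point_unique)
  show "ball_proj \<rho> y \<in> cball 0 \<rho>" using \<rho> by (auto simp: ball_proj_def)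
  show "\<forall>z\<in>cball 0 \<rho>. dist y (ball_proj \<rho> y) \<le> dist y z"
  proof
    fix z :: 'a assume z: "z \<in> cball 0 \<rho>"
    show "dist y (ball_proj \<rho> y) \<le> dist y z"
    proof (cases "norm y \<le> \<rho>")
      case False
      then have y0: "norm y > 0" using \<rho> by linarith
      have "y - (\<rho> / norm y) *\<^sub>R y = ((norm y - \<rho>) / norm y) *\<^sub>R y"
        using y0 by (simp add: diff_divide_distrib scaleR_diff_left)
      then have "dist y (ball_proj \<rho> y) = norm y - \<rho>"
        using False y0 by (simp add: ball_proj_def dist_norm)
      also have "\<dots> \<le> norm y - norm z" using z by simp
      also have "\<dots> \<le> dist y z" by (simp add: dist_norm norm_triangle_ineq2)
      finally show ?thesis .
    qed (simp add: ball_proj_def)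
  qed
qed auto

lemma ball_proj_lipschitz: "\<rho> > 0 \<Longrightarrow> norm (ball_proj \<rho> y - ball_proj \<rho> z) \<le> norm (y - z)"
  using closest_point_lipschitz[of "cball 0 \<rho>" y z] by (simp add: ball_proj_eq_closest_point dist_norm)

text \<open>The convex conjugate of \<open>z \<mapsto> \<bar>z\<bar>\<^sup>2 / 2\<close> restricted to the ball of radius \<open>\<rho>\<close>;
  its gradient is the maximiser, i.e. the projection.\<close>

definition huber :: "real \<Rightarrow> 'a::euclidean_space \<Rightarrow> real" where
  "huber \<rho> y = y \<bullet> ball_proj \<rho> y - (norm (ball_proj \<rho> y))\<^sup>2 / 2"

text \<open>Since \<open>y \<bullet> z - |z|^2/2 = (|y|^2 - |y - z|^2)/2\<close>, the point of the
  ball nearest to y is the maximiser.\<close>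

lemma huber_ge:
  assumes "\<rho> > 0" "norm z \<le> \<rho>"
  shows "y \<bullet> z - (norm z)\<^sup>2 / 2 \<le> huber \<rho> y"
proof -
  let ?p = "ball_proj \<rho> y"
  have "dist y ?p \<le> dist y z"
    unfolding ball_proj_eq_closest_point[OF assms(1)] using assms by (intro closest_point_le) auto
  then have "(norm (y - ?p))\<^sup>2 \<le> (norm (y - z))\<^sup>2" by (intro power_mono) (auto simp: dist_norm)
  then show ?thesis
    by (simp add: huber_def power2_norm_eq_inner inner_diff_left inner_diff_right inner_commute field_simps)
qed

lemma norm_ball_proj_le: "\<rho> > 0 \<Longrightarrow> norm (ball_proj \<rho> y) \<le> \<rho>"
  by (auto simp: ball_proj_def)

text \<open>Inserting the maximiser at y into the supremum at z, and conversely, squeezes the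
  remainder between 0 and \<open>(P z - P y) \<bullet> (z - y) \<le> |z - y|^2\<close>. Hence d = e
  works, and the sphere of radius \<rho>, where the formula changes, is covered by the same
  argument.\<close>

lemma has_derivative_huber:
  assumes \<rho>: "\<rho> > 0"
  shows "(huber \<rho> has_derivative (\<lambda>h. ball_proj \<rho> y \<bullet> h)) (at y)"
  unfolding has_derivative_at_alt
proof (intro conjI allI impI)
  show "bounded_linear (\<lambda>h. ball_proj \<rho> y \<bullet> h)" by (rule bounded_linear_inner_right)
  fix e :: real assume e: "e > 0"
  show "\<exists>d>0. \<forall>z. norm (z - y) < d \<longrightarrow> norm (huber \<rho> z - huber \<rho> y - ball_proj \<rho> y \<bullet> (z - y)) \<le> e * norm (z - y)"
  proof (intro exI[of _ e] conjI allI impI e)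
    fix z assume z: "norm (z - y) < e"
    let ?P = "ball_proj \<rho>"
    have 1: "z \<bullet> ?P y - (norm (?P y))\<^sup>2 / 2 \<le> huber \<rho> z" "y \<bullet> ?P z - (norm (?P z))\<^sup>2 / 2 \<le> huber \<rho> y"
      by (intro huber_ge \<rho> norm_ball_proj_le)+
    have low: "0 \<le> huber \<rho> z - huber \<rho> y - ?P y \<bullet> (z - y)"
      using 1(1) unfolding huber_def[of \<rho> y] by (simp add: inner_diff_right inner_diff_left inner_commute)
    have "huber \<rho> z - huber \<rho> y - ?P y \<bullet> (z - y) \<le> (?P z - ?P y) \<bullet> (z - y)"
      using 1(2) unfolding huber_def[of \<rho> z] by (simp add: inner_diff_right inner_diff_left inner_commute)
    also have "\<dots> \<le> norm (?P z - ?P y) * norm (z - y)" by (rule norm_cauchy_schwarz)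
    also have "\<dots> \<le> e * norm (z - y)"
      using ball_proj_lipschitz[OF \<rho>, of z y] z by (intro mult_right_mono) auto
    finally show "norm (huber \<rho> z - huber \<rho> y - ?P y \<bullet> (z - y)) \<le> e * norm (z - y)" using low by simp
  qed
qed

section \<open>The extremal bump\<close>

text \<open>The radial profile has second derivative -1 up to h/2, then 1 up to h, then 0. As a
  combination of two conjugates it is differentiable across both spheres without gluing; the outer
  parts add up to -h^2/4, which the constant compensates.\<close>

definition bump :: "real \<Rightarrow> 'a::euclidean_space \<Rightarrow> real" where
  "bump h y = huber h y - 2 * huber (h / 2) y + h\<^sup>2 / 4"

definition bump_grad :: "real \<Rightarrow> 'a::euclidean_space \<Rightarrow> 'a" where
  "bump_grad h y = ball_proj h y - 2 *\<^sub>R ball_proj (h / 2) y"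

lemma huber_eq:
  assumes "\<rho> > 0"
  shows "huber \<rho> y = (if norm y \<le> \<rho> then (norm y)\<^sup>2 / 2 else \<rho> * norm y - \<rho>\<^sup>2 / 2)"
proof (cases "norm y \<le> \<rho>")
  case True
  then show ?thesis by (simp add: huber_def ball_proj_def dot_square_norm)
next
  case False
  then have "norm y > 0" using assms by linarith
  then show ?thesis using False assms
    by (simp add: huber_def ball_proj_def dot_square_norm power2_eq_square)
qed

lemma bump_eq:
  assumes h: "h > 0"
  shows "bump h y = (if norm y \<le> h / 2 then h\<^sup>2 / 4 - (norm y)\<^sup>2 / 2
                     else if norm y \<le> h then (h - norm y)\<^sup>2 / 2 else 0)"
  using h by (auto simp: bump_def huber_eq power2_eq_square field_simps)

lemma abs_bump_le:
  assumes h: "h > 0"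
  shows "\<bar>bump h y\<bar> \<le> h\<^sup>2 / 4"
proof -
  consider "norm y \<le> h / 2" | "h / 2 < norm y" "norm y \<le> h" | "norm y > h" by linarith
  then show ?thesis
  proof cases
    case 1
    then have "(norm y)\<^sup>2 \<le> (h / 2)\<^sup>2" by (intro power_mono) auto
    then have "(norm y)\<^sup>2 \<le> h\<^sup>2 / 4" by (simp add: power_divide)
    moreover have "bump h y = h\<^sup>2 / 4 - (norm y)\<^sup>2 / 2" using 1 h by (simp add: bump_eq)
    ultimately show ?thesis using zero_le_power2[of "norm y"] by (intro abs_leI) linarith+
  next
    case 2
    then have "(h - norm y)\<^sup>2 \<le> (h / 2)\<^sup>2" by (intro power_mono) auto
    then have "(h - norm y)\<^sup>2 \<le> h\<^sup>2 / 4" by (simp add: power_divide)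
    moreover have "bump h y = (h - norm y)\<^sup>2 / 2" using 2 h by (simp add: bump_eq)
    ultimately show ?thesis using zero_le_power2[of "h - norm y"] by (intro abs_leI) linarith+
  qed (use h in \<open>simp add: bump_eq\<close>)
qed

lemma has_derivative_bump:
  "h > 0 \<Longrightarrow> (bump h has_derivative (\<lambda>v. bump_grad h y \<bullet> v)) (at y)"
  unfolding bump_def[abs_def] bump_grad_def
  by (auto intro!: derivative_eq_intros has_derivative_huber simp: inner_diff_left)

text \<open>The constant 3 = 1 + 2 is crude; it serves continuity and absolute continuity of the
  gradient. The sharp bound 1 comes from the second derivatives off the two spheres.\<close>

lemma bump_grad_lipschitz:
  assumes "h > 0"
  shows "norm (bump_grad h y - bump_grad h z) \<le> 3 * norm (y - z)"
proof -
  have "bump_grad h y - bump_grad h z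
      = (ball_proj h y - ball_proj h z) - 2 *\<^sub>R (ball_proj (h/2) y - ball_proj (h/2) z)"
    by (simp add: bump_grad_def algebra_simps)
  also have "norm \<dots> \<le> norm (ball_proj h y - ball_proj h z) + 2 * norm (ball_proj (h/2) y - ball_proj (h/2) z)"
    using norm_triangle_ineq4[of "ball_proj h y - ball_proj h z" "2 *\<^sub>R (ball_proj (h/2) y - ball_proj (h/2) z)"] by simp
  also have "\<dots> \<le> 3 * norm (y - z)"
    using ball_proj_lipschitz[of h y z] ball_proj_lipschitz[of "h/2" y z] assms by simp
  finally show ?thesis .
qed

lemma bump_grad_eq:
  assumes "h > 0"
  shows "bump_grad h y = (if norm y \<le> h / 2 then - y else if norm y \<le> h then y - (h / norm y) *\<^sub>R y else 0)"
proof (cases "norm y \<le> h / 2")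
  case True
  then show ?thesis using assms by (simp add: bump_grad_def ball_proj_def scaleR_2)
next
  case False
  then show ?thesis using assms by (simp add: bump_grad_def ball_proj_def)
qed

text \<open>Inside, the Hessian is minus the identity. In the shell it has eigenvalue 1 radially and
  1 - h/|y| tangentially, and |y| > h/2 keeps the latter above -1. The two spheres where the formula
  changes are null sets.\<close>

lemma bump_second_derivative:
  fixes y u :: "'a::euclidean_space"
  assumes h: "h > 0" and u: "norm u = 1" and y: "norm y \<noteq> h / 2" "norm y \<noteq> h"
  shows "\<exists>s. ((\<lambda>t. bump_grad h (y + t *\<^sub>R u) \<bullet> u) has_real_derivative s) (at 0) \<and> \<bar>s\<bar> \<le> 1"
proof -
  have uu: "u \<bullet> u = 1" using u by (simp add: dot_square_norm)
  have lim: "((\<lambda>t. norm (y + t *\<^sub>R u)) \<longlongrightarrow> norm y) (nhds 0)"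
  proof -
    have "isCont (\<lambda>t. norm (y + t *\<^sub>R u)) 0" by (intro continuous_intros)
    then show ?thesis
      using tendsto_at_iff_tendsto_nhds[of "\<lambda>t. norm (y + t *\<^sub>R u)" 0] by (simp add: isCont_def)
  qed
  consider "norm y < h / 2" | "h / 2 < norm y" "norm y < h" | "norm y > h" using y by linarith
  then show ?thesis
  proof cases
    case 1
    have ev: "\<forall>\<^sub>F t in nhds 0. bump_grad h (y + t *\<^sub>R u) \<bullet> u = - (y \<bullet> u) - t"
      using order_tendstoD(2)[OF lim 1]
      by eventually_elim (simp add: bump_grad_eq[OF h] inner_add_left inner_diff_left uu)
    have "((\<lambda>t. - (y \<bullet> u) - t) has_real_derivative -1) (at 0)"
      by (auto intro!: derivative_eq_intros)
    then have "((\<lambda>t. bump_grad h (y + t *\<^sub>R u) \<bullet> u) has_real_derivative -1) (at 0)"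
      using DERIV_cong_ev[OF refl ev refl] by blast
    then show ?thesis by (intro exI[of _ "-1"]) simp
  next
    case 2
    define n where "n = norm y"
    define a where "a = y \<bullet> u"
    have n: "n > 0" "h / 2 < n" "n < h" using 2 h by (auto simp: n_def)
    have ev: "\<forall>\<^sub>F t in nhds 0. bump_grad h (y + t *\<^sub>R u) \<bullet> u = (a + t) - h * (a + t) / norm (y + t *\<^sub>R u)"
      using order_tendstoD(1)[OF lim 2(1)] order_tendstoD(2)[OF lim 2(2)]
    proof eventually_elim
      case (elim t)
      then show ?case by (simp add: bump_grad_eq[OF h] inner_add_left inner_diff_left uu a_def)
    qed
    have dn: "((\<lambda>t. norm (y + t *\<^sub>R u)) has_real_derivative a / n) (at 0)"
    proof -
      have "y \<noteq> 0" using n by (auto simp: n_def)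
      have "((\<lambda>t. norm (y + t *\<^sub>R u)) has_derivative (\<lambda>r. (r *\<^sub>R u) \<bullet> sgn (y + 0 *\<^sub>R u))) (at 0)"
        using \<open>y \<noteq> 0\<close>
        by (intro has_derivative_compose[OF _ has_derivative_norm]) (auto intro!: derivative_eq_intros)
      moreover have "(\<lambda>r. (r *\<^sub>R u) \<bullet> sgn (y + 0 *\<^sub>R u)) = (*) (a / n)"
        by (rule ext) (simp add: sgn_div_norm a_def n_def inner_commute field_simps)
      ultimately show ?thesis by (simp add: has_field_derivative_def)
    qed
    define s where "s = 1 - h / n * (1 - (a / n)\<^sup>2)"
    have "((\<lambda>t. (a + t) - h * (a + t) / norm (y + t *\<^sub>R u)) has_real_derivative
        1 - (h * norm (y + 0 *\<^sub>R u) - h * (a + 0) * (a / n)) / (norm (y + 0 *\<^sub>R u) * norm (y + 0 *\<^sub>R u))) (at 0)"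
      using n by (auto intro!: derivative_eq_intros dn simp: n_def)
    moreover have "1 - (h * norm (y + 0 *\<^sub>R u) - h * (a + 0) * (a / n)) / (norm (y + 0 *\<^sub>R u) * norm (y + 0 *\<^sub>R u)) = s"
      using n by (simp add: s_def n_def[symmetric] power2_eq_square field_simps)
    ultimately have "((\<lambda>t. bump_grad h (y + t *\<^sub>R u) \<bullet> u) has_real_derivative s) (at 0)"
      using DERIV_cong_ev[OF refl ev refl] by simp
    moreover have "\<bar>s\<bar> \<le> 1"
    proof -
      have "\<bar>a\<bar> \<le> n" using Cauchy_Schwarz_ineq2[of y u] u by (simp add: a_def n_def)
      then have "\<bar>a / n\<bar> \<le> 1" using n by (simp add: abs_divide)
      then have "(a / n)\<^sup>2 \<le> 1" by (simp add: abs_square_le_1)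
      then have w: "0 \<le> 1 - (a / n)\<^sup>2" "1 - (a / n)\<^sup>2 \<le> 1" by auto
      have hn: "0 \<le> h / n" "h / n \<le> 2" using n h by (auto simp: field_simps)
      have "0 \<le> h / n * (1 - (a / n)\<^sup>2)" "h / n * (1 - (a / n)\<^sup>2) \<le> 2 * 1"
        using w hn by (intro mult_nonneg_nonneg mult_mono; simp)+
      then show ?thesis by (simp add: s_def)
    qed
    ultimately show ?thesis by blast
  next
    case 3
    have ev: "\<forall>\<^sub>F t in nhds 0. bump_grad h (y + t *\<^sub>R u) \<bullet> u = 0"
      using order_tendstoD(1)[OF lim 3]
      by eventually_elim (use h in \<open>simp add: bump_grad_eq[OF h]\<close>)
    have "((\<lambda>t. 0) has_real_derivative 0) (at (0::real))" by simp
    then have "((\<lambda>t. bump_grad h (y + t *\<^sub>R u) \<bullet> u) has_real_derivative 0) (at 0)"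
      using DERIV_cong_ev[OF refl ev refl] by blast
    then show ?thesis by (intro exI[of _ 0]) simp
  qed
qed

lemma lipschitz_imp_abs_cont_on:
  assumes C: "C > 0" and lip: "\<And>s t. \<bar>h s - h t\<bar> \<le> C * \<bar>s - t\<bar>"
  shows "abs_cont_on S h"
  unfolding abs_cont_on_def
proof (intro allI impI)
  fix e :: real assume e: "e > 0"
  show "\<exists>\<delta>>0. \<forall>(n::nat) a b. (\<forall>i<n. a i \<le> b i \<and> {a i..b i} \<subseteq> S) \<and>
        (\<forall>i<n. \<forall>j<n. i \<noteq> j \<longrightarrow> b i \<le> a j \<or> b j \<le> a i) \<and> (\<Sum>i<n. b i - a i) < \<delta>
        \<longrightarrow> (\<Sum>i<n. \<bar>h (b i) - h (a i)\<bar>) < e"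
  proof (intro exI[of _ "e / C"] conjI allI impI)
    fix n :: nat and a b :: "nat \<Rightarrow> real"
    assume as: "(\<forall>i<n. a i \<le> b i \<and> {a i..b i} \<subseteq> S) \<and>
        (\<forall>i<n. \<forall>j<n. i \<noteq> j \<longrightarrow> b i \<le> a j \<or> b j \<le> a i) \<and> (\<Sum>i<n. b i - a i) < e / C"
    have "(\<Sum>i<n. \<bar>h (b i) - h (a i)\<bar>) \<le> (\<Sum>i<n. C * (b i - a i))"
    proof (rule sum_mono)
      fix i assume "i \<in> {..<n}"
      then show "\<bar>h (b i) - h (a i)\<bar> \<le> C * (b i - a i)" using lip[of "b i" "a i"] as by auto
    qed
    also have "\<dots> = C * (\<Sum>i<n. b i - a i)" by (simp add: sum_distrib_left)
    also have "\<dots> < C * (e / C)" using as C by (intro mult_strict_left_mono) auto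
    finally show "(\<Sum>i<n. \<bar>h (b i) - h (a i)\<bar>) < e" using C by simp
  qed (use e C in simp)
qed

text \<open>The zero-order term adds at most |q| h^2/4 to a second derivative of size at most 1, and
  \<kappa> scales the sum back to 1. The bump lives on the whole space, so its support may leave
  \<Omega>; this matters for centres near the boundary.\<close>

lemma bump_in_W_class:
  fixes c :: "'a::euclidean_space"
  assumes h: "h > 0" and \<kappa>: "\<bar>\<kappa>\<bar> * (1 + \<bar>q\<bar> * (h\<^sup>2 / 4)) \<le> 1"
  shows "(\<lambda>x. \<kappa> * bump h (x - c)) \<in> W_class \<Omega> 0 q"
  unfolding W_class_iff W_grad_def
proof (intro exI[of _ "\<lambda>x. \<kappa> *\<^sub>R bump_grad h (x - c)"] conjI ballI allI impI)
  let ?g = "\<lambda>x. \<kappa> *\<^sub>R bump_grad h (x - c)"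
  \<comment> \<open>The summand 1 keeps the constant positive for \<kappa> = 0, the case that
    supplies the zero function.\<close>
  have lip: "norm (?g x - ?g y) \<le> (3 * \<bar>\<kappa>\<bar> + 1) * norm (x - y)" for x y
  proof -
    have "norm (?g x - ?g y) = \<bar>\<kappa>\<bar> * norm (bump_grad h (x - c) - bump_grad h (y - c))"
      by (simp flip: scaleR_diff_right)
    also have "\<dots> \<le> \<bar>\<kappa>\<bar> * (3 * norm (x - y))"
      using bump_grad_lipschitz[OF h, of "x - c" "y - c"] by (intro mult_left_mono) auto
    also have "\<dots> \<le> (3 * \<bar>\<kappa>\<bar> + 1) * norm (x - y)" by (simp add: algebra_simps)
    finally show ?thesis .
  qed
  {
    fix x
    have "((\<lambda>x. bump h (x - c)) has_derivative (\<lambda>v. bump_grad h (x - c) \<bullet> v)) (at x within \<Omega>)"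
      by (rule has_derivative_compose[OF _ has_derivative_bump[OF h]]) (auto intro!: derivative_eq_intros)
    then show "((\<lambda>x. \<kappa> * bump h (x - c)) has_derivative (\<bullet>) (\<kappa> *\<^sub>R bump_grad h (x - c))) (at x within \<Omega>)"
      by (auto intro!: derivative_eq_intros)
  }
  have "(3 * \<bar>\<kappa>\<bar> + 1)-lipschitz_on \<Omega> ?g"
    using lip by (intro lipschitz_onI) (auto simp: dist_norm)
  then show "continuous_on \<Omega> ?g" by (rule lipschitz_on_continuous_on)
  fix u :: 'a assume u: "norm u = 1"
  have "\<bar>?g (x + s *\<^sub>R u) \<bullet> u - ?g (x + t *\<^sub>R u) \<bullet> u\<bar> \<le> (3 * \<bar>\<kappa>\<bar> + 1) * \<bar>s - t\<bar>" for x s t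
  proof -
    have "\<bar>?g (x + s *\<^sub>R u) \<bullet> u - ?g (x + t *\<^sub>R u) \<bullet> u\<bar> \<le> norm (?g (x + s *\<^sub>R u) - ?g (x + t *\<^sub>R u)) * norm u"
      by (metis Cauchy_Schwarz_ineq2 inner_diff_left)
    also have "\<dots> \<le> (3 * \<bar>\<kappa>\<bar> + 1) * norm ((x + s *\<^sub>R u) - (x + t *\<^sub>R u))" unfolding u mult_1_right by (rule lip)
    also have "(x + s *\<^sub>R u) - (x + t *\<^sub>R u) = (s - t) *\<^sub>R u" by (simp add: algebra_simps)
    finally show ?thesis using u by simp
  qed
  then have "abs_cont_on S (\<lambda>t. ?g (x + t *\<^sub>R u) \<bullet> u)" for x S
    by (intro lipschitz_imp_abs_cont_on[of "3 * \<bar>\<kappa>\<bar> + 1"]) auto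
  then show "AE x in lebesgue. x \<in> interior \<Omega> \<longrightarrow>
             loc_abs_cont_on {t. x + t *\<^sub>R u \<in> interior \<Omega>} (\<lambda>t. ?g (x + t *\<^sub>R u) \<bullet> u)"
    by (simp add: loc_abs_cont_on_def)
  have "negligible (sphere c (h / 2) \<union> sphere c h)"
    by (intro negligible_Un negligible_sphere)
  then have "AE x in lebesgue. x \<notin> sphere c (h / 2) \<union> sphere c h"
    by (intro AE_not_in) (simp add: negligible_iff_null_sets)
  then show "AE x in lebesgue. x \<in> \<Omega> \<longrightarrow>
             (\<exists>s. ((\<lambda>t. ?g (x + t *\<^sub>R u) \<bullet> u) has_real_derivative s) (at 0) \<and>
                  \<bar>s + 0 * (?g x \<bullet> u) + q * (\<kappa> * bump h (x - c))\<bar> \<le> 1)"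
  proof eventually_elim
    case (elim x)
    then have nx: "norm (x - c) \<noteq> h / 2" "norm (x - c) \<noteq> h" by (auto simp: dist_norm norm_minus_commute)
    obtain s where s: "((\<lambda>t. bump_grad h (x - c + t *\<^sub>R u) \<bullet> u) has_real_derivative s) (at 0)" "\<bar>s\<bar> \<le> 1"
      using bump_second_derivative[OF h u nx] by blast
    have "((\<lambda>t. ?g (x + t *\<^sub>R u) \<bullet> u) has_real_derivative \<kappa> * s) (at 0)"
      using DERIV_cmult[OF s(1), of \<kappa>] by (simp add: algebra_simps)
    moreover have "\<bar>\<kappa> * s + q * (\<kappa> * bump h (x - c))\<bar> \<le> 1"
    proof -
      have "\<bar>s + q * bump h (x - c)\<bar> \<le> 1 + \<bar>q\<bar> * (h\<^sup>2 / 4)"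
        using s(2) mult_left_mono[OF abs_bump_le[OF h, of "x - c"], of "\<bar>q\<bar>"]
          abs_triangle_ineq[of s "q * bump h (x - c)"] by (simp add: abs_mult)
      then have "\<bar>\<kappa>\<bar> * \<bar>s + q * bump h (x - c)\<bar> \<le> 1"
        by (rule order_trans[OF mult_left_mono \<kappa>]) simp
      then show ?thesis by (simp add: algebra_simps flip: abs_mult)
    qed
    ultimately show ?case by auto
  qed
qed

text \<open>The strict distance puts every node into the open complement of the support of the bump,
  where the function and its negative agree. Whatever value an algorithm returns at c misses one of
  the two by at least the height.\<close>

lemma recovery_error_ge:
  fixes \<Omega> :: "'a::euclidean_space set"
  assumes h: "h > 0" and c: "c \<in> \<Omega>" and \<xi>: "\<xi> \<subseteq> \<Omega>" and far: "\<And>z. z \<in> \<xi> \<Longrightarrow> h < dist c z"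
  shows "ereal ((h\<^sup>2 / 4) / (1 + \<bar>q\<bar> * (h\<^sup>2 / 4))) \<le> recovery_error \<Omega> 0 q \<xi>"
proof -
  define N where "N = 1 + \<bar>q\<bar> * (h\<^sup>2 / 4)"
  have N: "N > 0" by (simp add: N_def add_pos_nonneg)
  define f where "f \<sigma> x = (\<sigma> / N) * bump h (x - c)" for \<sigma> x
  have fW: "f \<sigma> \<in> W_class \<Omega> 0 q" if "\<bar>\<sigma>\<bar> = 1" for \<sigma>
    unfolding f_def by (rule bump_in_W_class[OF h], unfold N_def[symmetric]) (use that N in \<open>simp add: abs_divide\<close>)
  have fc: "f \<sigma> c = \<sigma> * ((h\<^sup>2 / 4) / N)" for \<sigma>
    using h by (simp add: f_def bump_eq)
  have info_eq: "info \<Omega> \<xi> (f 1) = info \<Omega> \<xi> (f (-1))"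
  proof
    fix z
    have "f 1 z = f (-1) z \<and> grad_on \<Omega> (f 1) z = grad_on \<Omega> (f (-1)) z" if z: "z \<in> \<xi>"
    proof -
      have zero: "f \<sigma> x = 0" if "x \<in> - cball c h" for x \<sigma>
        using that h by (auto simp: f_def bump_eq dist_norm norm_minus_commute)
      have zin: "z \<in> - cball c h" using far[OF z] by simp
      \<comment> \<open>\<open>grad_on\<close> is a choice, so its equality is obtained from
        equality of the two sets of admissible gradients, which follows from agreement near
        z.\<close>
      have "(f 1 has_derivative A) (at z within \<Omega>) = (f (-1) has_derivative A) (at z within \<Omega>)" for A
      proof -
        have ev: "\<forall>\<^sub>F x in at z within \<Omega>. f 1 x = f (-1) x"
          using zero zin by (auto simp: eventually_at_topological intro!: exI[of _ "- cball c h"])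
        have ev': "\<forall>\<^sub>F x in at z within \<Omega>. f (-1) x = f 1 x" using ev by eventually_elim simp
        have "z \<in> \<Omega>" using z \<xi> by blast
        then show ?thesis
          using has_derivative_transform_eventually[OF _ ev] has_derivative_transform_eventually[OF _ ev']
            zero[OF zin] by metis
      qed
      then show ?thesis using zero[OF zin] by (simp add: grad_on_def)
    qed
    then show "info \<Omega> \<xi> (f 1) z = info \<Omega> \<xi> (f (-1)) z" by (auto simp: info_def)
  qed
  show ?thesis unfolding recovery_error_def
  proof (rule INF_greatest)
    fix \<phi> :: "('a \<Rightarrow> real \<times> 'a) \<Rightarrow> 'a \<Rightarrow> real"
    let ?E = "SUP f \<in> W_class \<Omega> 0 q. SUP x \<in> \<Omega>. ereal \<bar>f x - \<phi> (info \<Omega> \<xi> f) x\<bar>"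
    have le: "ereal \<bar>f \<sigma> c - \<phi> (info \<Omega> \<xi> (f \<sigma>)) c\<bar> \<le> ?E" if "\<bar>\<sigma>\<bar> = 1" for \<sigma>
      by (rule order_trans[OF SUP_upper[OF c] SUP_upper[OF fW[OF that]]])
    let ?p = "\<phi> (info \<Omega> \<xi> (f 1)) c" and ?v = "(h\<^sup>2 / 4) / N"
    have "?v \<le> \<bar>f 1 c - ?p\<bar> \<or> ?v \<le> \<bar>f (-1) c - ?p\<bar>" unfolding fc by linarith
    then have "ereal ?v \<le> ?E"
      using le[of 1] le[of "-1"] unfolding info_eq by (auto intro: order_trans[rotated])
    then show "ereal ((h\<^sup>2 / 4) / (1 + \<bar>q\<bar> * (h\<^sup>2 / 4))) \<le> ?E" by (simp add: N_def)
  qed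
qed

text \<open>Over an empty set the supremum in \<open>ereal\<close> is minus infinity; a point of
  \<Omega> and the zero function in the class exclude this.\<close>

lemma recovery_error_nonneg:
  assumes "\<Omega> \<noteq> {}"
  shows "0 \<le> recovery_error \<Omega> 0 q \<xi>"
proof -
  obtain c where c: "c \<in> \<Omega>" using assms by blast
  have "(\<lambda>x. 0 * bump 1 (x - 0)) \<in> W_class \<Omega> 0 q" by (rule bump_in_W_class) auto
  then have W: "(\<lambda>x. 0) \<in> W_class \<Omega> 0 q" by simp
  show ?thesis unfolding recovery_error_def
  proof (rule INF_greatest)
    fix \<phi> :: "('a \<Rightarrow> real \<times> 'a) \<Rightarrow> 'a \<Rightarrow> real"
    have "0 \<le> ereal \<bar>0 - \<phi> (info \<Omega> \<xi> (\<lambda>x. 0)) c\<bar>" by simp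
    also have "\<dots> \<le> (SUP f \<in> W_class \<Omega> 0 q. SUP x \<in> \<Omega>. ereal \<bar>f x - \<phi> (info \<Omega> \<xi> f) x\<bar>)"
      by (rule order_trans[OF SUP_upper[OF c] SUP_upper[OF W]])
    finally show "0 \<le> (SUP f \<in> W_class \<Omega> 0 q. SUP x \<in> \<Omega>. ereal \<bar>f x - \<phi> (info \<Omega> \<xi> f) x\<bar>)" .
  qed
qed

section \<open>Covering numbers\<close>

definition cube :: "real \<Rightarrow> 'a::euclidean_space set" where
  "cube R = cbox (- R *\<^sub>R One) (R *\<^sub>R One)"

lemma mem_scaled_box:
  "x \<in> cbox (a *\<^sub>R One) (b *\<^sub>R One) \<longleftrightarrow> (\<forall>i\<in>Basis. a \<le> x \<bullet> i \<and> x \<bullet> i \<le> b)"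
  by (simp add: mem_box)

lemma mem_cube: "x \<in> cube R \<longleftrightarrow> (\<forall>i\<in>Basis. \<bar>x \<bullet> i\<bar> \<le> R)"
  by (auto simp: cube_def mem_box abs_le_iff)

lemma emeasure_scaled_box:
  assumes "a \<le> b"
  shows "emeasure lborel (cbox (a *\<^sub>R One) (b *\<^sub>R (One::'a::euclidean_space))) = ennreal ((b - a) ^ DIM('a))"
  using assms by (simp add: emeasure_lborel_cbox_eq inner_diff_left prod_ennreal[symmetric] del: prod_constant)
     (simp add: ennreal_power)

lemma measure_scaled_box:
  assumes "a \<le> b"
  shows "measure lborel (cbox (a *\<^sub>R One) (b *\<^sub>R (One::'a::euclidean_space))) = (b - a) ^ DIM('a)"
  unfolding measure_def emeasure_scaled_box[OF assms] using assms by simp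

lemma compact_cube: "compact (cube R)"
  unfolding cube_def by (rule compact_cbox)

lemma cube_borel [measurable, simp]: "cube R \<in> sets borel"
  by (simp add: borel_compact compact_cube)

lemma emeasure_cube:
  "R \<ge> 0 \<Longrightarrow> emeasure lborel (cube R :: 'a::euclidean_space set) = ennreal ((2 * R) ^ DIM('a))"
  unfolding cube_def by (subst emeasure_scaled_box) auto

lemma measure_cube:
  "R \<ge> 0 \<Longrightarrow> measure lborel (cube R :: 'a::euclidean_space set) = (2 * R) ^ DIM('a)"
  unfolding cube_def by (subst measure_scaled_box) auto

lemma emeasure_reflected:
  fixes B :: "'a::euclidean_space set"
  assumes [measurable]: "B \<in> sets borel"
  shows "emeasure lborel {t. c - t \<in> B} = emeasure lborel B"
proof -
  have "(lborel :: 'a measure) = distr lborel borel (\<lambda>x. c - x)"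
    using lborel_affine[of "-1" c] by (simp add: density_1)
  then have "emeasure lborel B = emeasure (distr lborel borel (\<lambda>x. c - x)) B" by simp
  also have "\<dots> = emeasure lborel {t. c - t \<in> B}"
    by (subst emeasure_distr) (auto simp: vimage_def)
  finally show ?thesis by simp
qed

text \<open>Integrate the number of points of \<open>X\<close> in the translate \<open>t + B\<close> over \<open>t \<in> T\<close>.\<close>

lemma translates_average:
  fixes X :: "'a::euclidean_space set"
  assumes X: "finite X" and B: "B \<in> sets borel" "emeasure lborel B < \<infinity>"
    and T: "T \<in> sets borel" "emeasure lborel T < \<infinity>"
    and m: "\<And>t. t \<in> T \<Longrightarrow> m \<le> card {c \<in> X. c - t \<in> B}"
  shows "real m * measure lborel T \<le> real (card X) * measure lborel B"
proof -
  note [measurable] = B(1) T(1)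
  have "of_nat m * emeasure lborel T = (\<integral>\<^sup>+t. of_nat m * indicator T t \<partial>lborel)"
    by (simp add: nn_integral_cmult_indicator)
  also have "\<dots> \<le> (\<integral>\<^sup>+t. (\<Sum>c\<in>X. indicator {t. c - t \<in> B} t) \<partial>lborel)"
  proof (rule nn_integral_mono)
    fix t :: 'a
    have "{c \<in> X. c - t \<in> B} = X \<inter> {c. c - t \<in> B}" by auto
    then have "(\<Sum>c\<in>X. indicator {t. c - t \<in> B} t) = (of_nat (card {c \<in> X. c - t \<in> B}) :: ennreal)"
      by (simp add: indicator_def of_bool_def sum.If_cases[OF X])
    then show "of_nat m * indicator T t \<le> (\<Sum>c\<in>X. indicator {t. c - t \<in> B} t :: ennreal)"
      using m[of t] by (cases "t \<in> T") auto
  qed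
  also have "\<dots> = (\<Sum>c\<in>X. emeasure lborel {t. c - t \<in> B})"
    by (subst nn_integral_sum) auto
  also have "\<dots> = of_nat (card X) * emeasure lborel B"
    by (simp add: emeasure_reflected[OF B(1)])
  finally have "ennreal (real m * measure lborel T) \<le> ennreal (real (card X) * measure lborel B)"
    using B T by (simp add: emeasure_eq_ennreal_measure ennreal_mult' ennreal_of_nat_eq_real_of_nat less_top)
  then show ?thesis by (simp add: ennreal_le_iff)
qed

lemma card_integer_points:
  defines "Z \<equiv> {k::'a::euclidean_space. \<forall>i\<in>Basis. k \<bullet> i \<in> \<int>}"
  assumes M: "M \<ge> 0"
  shows "countable Z" "finite (Z \<inter> cube M)" "real (card (Z \<inter> cube M)) \<le> (2 * M + 1) ^ DIM('a)"
proof -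
  let ?f = "\<lambda>k::'a. \<lambda>i\<in>Basis. \<lfloor>k \<bullet> i\<rfloor>"
  have inj: "inj_on ?f Z"
  proof (rule inj_onI)
    fix k l assume kl: "k \<in> Z" "l \<in> Z" "?f k = ?f l"
    show "k = l"
    proof (rule euclidean_eqI)
      fix i :: 'a assume i: "i \<in> Basis"
      have "\<lfloor>k \<bullet> i\<rfloor> = \<lfloor>l \<bullet> i\<rfloor>" using fun_cong[OF kl(3), of i] i by simp
      moreover have "k \<bullet> i \<in> \<int>" "l \<bullet> i \<in> \<int>" using kl i by (auto simp: Z_def)
      ultimately show "k \<bullet> i = l \<bullet> i" by (auto elim!: Ints_cases)
    qed
  qed
  have "countable (PiE (Basis::'a set) (\<lambda>_. UNIV::int set))" by (rule countable_PiE) auto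
  moreover have "?f ` Z \<subseteq> PiE Basis (\<lambda>_. UNIV)" by auto
  ultimately have "countable (?f ` Z)" using countable_subset by blast
  then show "countable Z" using inj countable_image_inj_on by blast
  let ?P = "PiE (Basis::'a set) (\<lambda>_. {-\<lfloor>M\<rfloor>..\<lfloor>M\<rfloor>})"
  have finP: "finite ?P" by (intro finite_PiE) auto
  have im: "?f ` (Z \<inter> cube M) \<subseteq> ?P"
  proof (rule image_subsetI, rule PiE_I)
    fix k i :: 'a assume k: "k \<in> Z \<inter> cube M" and i: "i \<in> Basis"
    have "\<bar>k \<bullet> i\<bar> \<le> M" using k i by (auto simp: mem_cube)
    moreover obtain n where n: "k \<bullet> i = of_int n" using k i by (auto simp: Z_def elim: Ints_cases)
    ultimately have "\<bar>n\<bar> \<le> \<lfloor>M\<rfloor>" by (simp add: le_floor_iff)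
    then have "\<bar>\<lfloor>k \<bullet> i\<rfloor>\<bar> \<le> \<lfloor>M\<rfloor>" by (simp add: n)
    then show "?f k i \<in> {-\<lfloor>M\<rfloor>..\<lfloor>M\<rfloor>}" using i by (simp add: abs_le_iff)
  qed auto
  have inj': "inj_on ?f (Z \<inter> cube M)" using inj by (rule inj_on_subset) auto
  show "finite (Z \<inter> cube M)" using finite_imageD[OF finite_subset[OF im finP] inj'] .
  have "card (Z \<inter> cube M) \<le> card ?P" by (rule card_inj_on_le[OF inj' im finP])
  also have "\<dots> = nat (2 * \<lfloor>M\<rfloor> + 1) ^ DIM('a)" by (simp add: card_PiE)
  finally have "real (card (Z \<inter> cube M)) \<le> real (nat (2 * \<lfloor>M\<rfloor> + 1)) ^ DIM('a)"
    by (metis of_nat_le_iff of_nat_power)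
  also have "\<dots> \<le> (2 * M + 1) ^ DIM('a)"
    using M by (intro power_mono) (auto simp: of_nat_nat)
  finally show "real (card (Z \<inter> cube M)) \<le> (2 * M + 1) ^ DIM('a)" .
qed

lemma mem_cball_inner:
  assumes "x \<in> cball c h" "i \<in> Basis"
  shows "\<bar>c \<bullet> i - x \<bullet> i\<bar> \<le> h"
  using assms Basis_le_norm[of i "c - x"] by (simp add: dist_norm inner_diff_left)

text \<open>The witness for the infimum repeats the given covering of the cube periodically.\<close>

lemma Theta_le_cube_covering:
  fixes \<xi> :: "'a::euclidean_space set"
  assumes fin: "finite \<xi>" and h: "h > 0" and a: "a > 0"
    and cov: "cbox 0 (a *\<^sub>R One) \<subseteq> (\<Union>c\<in>\<xi>. cball c h)"
  shows "Theta TYPE('a) \<le> ennreal (real (card \<xi>) * (unit_ball_vol (real DIM('a)) * h ^ DIM('a)) / a ^ DIM('a))"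
proof -
  let ?d = "DIM('a)"
  define V where "V = unit_ball_vol (real ?d) * h ^ ?d"
  have V: "V > 0" using h by (simp add: V_def)
  define Z where "Z = {k::'a. \<forall>i\<in>Basis. k \<bullet> i \<in> \<int>}"
  define C where "C = (\<lambda>(c, k). c + a *\<^sub>R k) ` (\<xi> \<times> Z)"
  have "countable Z" unfolding Z_def by (rule card_integer_points(1)[of 0]) simp
  then have cC: "countable C" unfolding C_def using fin by (intro countable_image countable_SIGMA) (auto intro: countable_finite)
  have covC: "(\<Union>c\<in>C. cball c h) = UNIV"
  proof (rule UNIV_eq_I[symmetric])
    fix x :: 'a
    define k where "k = (\<Sum>i\<in>Basis. of_int \<lfloor>(x \<bullet> i) / a\<rfloor> *\<^sub>R i)"
    have ki: "k \<bullet> i = of_int \<lfloor>(x \<bullet> i) / a\<rfloor>" if "i \<in> Basis" for i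
      using that by (simp add: k_def)
    have "x - a *\<^sub>R k \<in> cbox 0 (a *\<^sub>R One)"
      unfolding mem_box
    proof (intro ballI conjI)
      fix i :: 'a assume i: "i \<in> Basis"
      have "a * of_int \<lfloor>(x \<bullet> i) / a\<rfloor> \<le> a * ((x \<bullet> i) / a)"
        using a by (intro mult_left_mono of_int_floor_le) simp
      moreover have "a * ((x \<bullet> i) / a) \<le> a * (of_int \<lfloor>(x \<bullet> i) / a\<rfloor> + 1)"
        using a by (intro mult_left_mono) linarith+
      ultimately have "a * of_int \<lfloor>(x \<bullet> i) / a\<rfloor> \<le> x \<bullet> i" "x \<bullet> i \<le> a * of_int \<lfloor>(x \<bullet> i) / a\<rfloor> + a"
        using a by (simp_all add: distrib_left)
      then show "0 \<bullet> i \<le> (x - a *\<^sub>R k) \<bullet> i" "(x - a *\<^sub>R k) \<bullet> i \<le> (a *\<^sub>R One) \<bullet> i"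
        using i by (simp_all add: inner_diff_left ki)
    qed
    then obtain c where c: "c \<in> \<xi>" "dist c (x - a *\<^sub>R k) \<le> h" using cov by auto
    have "k \<in> Z" by (simp add: Z_def ki)
    then have "c + a *\<^sub>R k \<in> C" using c(1) by (auto simp: C_def)
    moreover have "x \<in> cball (c + a *\<^sub>R k) h" using c(2) by (simp add: dist_norm algebra_simps)
    ultimately show "x \<in> (\<Union>c\<in>C. cball c h)" by blast
  qed
  obtain m where m: "m \<ge> 0" "\<And>c. c \<in> \<xi> \<Longrightarrow> norm c \<le> m"
    using finite_imp_bounded[OF fin] bounded_pos[of \<xi>] by (meson less_imp_le)
  \<comment> \<open>If the ball about c + a k meets the cube of half-width R, then the coordinates
    of a k are at most R + h + m in absolute value, where m bounds the norms of the nodes.\<close>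
  define M where "M R = (R + h + m) / a" for R
  have bound: "(\<integral>\<^sup>+ c. emeasure lborel (cball c h \<inter> cube R) \<partial>count_space C) / emeasure lborel (cube R :: 'a set)
      \<le> ennreal (real (card \<xi>) * V * ((2 * M R + 1) / (2 * R)) ^ ?d)" if R: "R > 0" for R
  proof -
    \<comment> \<open>Different pairs may give the same centre, so the product bounds the number of
      centres only from above, the direction needed here.\<close>
    define D where "D = (\<lambda>(c, k). c + a *\<^sub>R k) ` (\<xi> \<times> (Z \<inter> cube (M R)))"
    have MR: "M R \<ge> 0" using R h m a by (simp add: M_def)
    note P = card_integer_points[OF MR, where 'a='a, folded Z_def]
    have finD: "finite D" using fin P(2) by (simp add: D_def)
    have "(\<integral>\<^sup>+ c. emeasure lborel (cball c h \<inter> cube R) \<partial>count_space C) = (\<Sum>c\<in>D. emeasure lborel (cball c h \<inter> cube R))"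
    proof (rule nn_integral_count_space'[OF finD])
      show "D \<subseteq> C" by (auto simp: D_def C_def)
      fix x assume "x \<in> C" and xD: "x \<notin> D"
      then obtain c k where ck: "c \<in> \<xi>" "k \<in> Z" "x = c + a *\<^sub>R k" by (auto simp: C_def)
      have "cball x h \<inter> cube R = {}"
      proof (rule ccontr)
        assume "\<not> ?thesis"
        then obtain y where y: "y \<in> cball x h" "y \<in> cube R" by blast
        have "k \<in> cube (M R)" unfolding mem_cube
        proof
          fix i :: 'a assume i: "i \<in> Basis"
          have "\<bar>x \<bullet> i - y \<bullet> i\<bar> \<le> h" "\<bar>y \<bullet> i\<bar> \<le> R" "\<bar>c \<bullet> i\<bar> \<le> m"
            using mem_cball_inner[OF y(1) i] y(2) i m(2)[OF ck(1)] Basis_le_norm[OF i, of c] by (auto simp: mem_cube)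
          moreover have "x \<bullet> i = c \<bullet> i + a * (k \<bullet> i)" by (simp add: ck inner_add_left)
          ultimately have "\<bar>a * (k \<bullet> i)\<bar> \<le> R + h + m" by linarith
          then show "\<bar>k \<bullet> i\<bar> \<le> M R" using a by (simp add: M_def abs_mult field_simps)
        qed
        then show False using ck xD by (auto simp: D_def)
      qed
      then show "emeasure lborel (cball x h \<inter> cube R) = 0" by simp
    qed
    also have "\<dots> \<le> (\<Sum>c\<in>D. ennreal V)"
    proof (rule sum_mono)
      fix c :: 'a
      have "emeasure lborel (cball c h \<inter> cube R) \<le> emeasure lborel (cball c h)" by (rule emeasure_mono) auto
      then show "emeasure lborel (cball c h \<inter> cube R) \<le> ennreal V" using h by (simp add: emeasure_cball V_def)
    qed
    also have "\<dots> = ennreal (real (card D) * V)" by (simp add: ennreal_mult' ennreal_of_nat_eq_real_of_nat)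
    also have "\<dots> \<le> ennreal (real (card \<xi>) * (2 * M R + 1) ^ ?d * V)"
    proof (intro ennreal_leI mult_right_mono)
      have "real (card D) \<le> real (card \<xi>) * real (card (Z \<inter> cube (M R)))"
        using card_image_le[of "\<xi> \<times> (Z \<inter> cube (M R))" "\<lambda>(c, k). c + a *\<^sub>R k"] fin P(2)
        unfolding D_def by (simp add: card_cartesian_product flip: of_nat_mult)
      also have "\<dots> \<le> real (card \<xi>) * (2 * M R + 1) ^ ?d" using P(3) by (intro mult_left_mono) auto
      finally show "real (card D) \<le> real (card \<xi>) * (2 * M R + 1) ^ ?d" .
    qed (use V in auto)
    finally have "(\<integral>\<^sup>+ c. emeasure lborel (cball c h \<inter> cube R) \<partial>count_space C) / emeasure lborel (cube R :: 'a set)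
      \<le> ennreal (real (card \<xi>) * (2 * M R + 1) ^ ?d * V) / ennreal ((2 * R) ^ ?d)"
      using R by (subst emeasure_cube) (auto intro: divide_right_mono_ennreal)
    also have "\<dots> = ennreal (real (card \<xi>) * V * ((2 * M R + 1) / (2 * R)) ^ ?d)"
      using R MR V by (subst divide_ennreal) (auto simp: power_divide mult_ac)
    finally show ?thesis .
  qed
  \<comment> \<open>The margins h, m and the extra 1 are of lower order in n, so the density of the
    periodic covering is at most the volume of the balls over one period, divided by a^d.\<close>
  have lim: "(\<lambda>n. ennreal (real (card \<xi>) * V * ((2 * M (real n) + 1) / (2 * real n)) ^ ?d))
      \<longlonglongrightarrow> ennreal (real (card \<xi>) * V * (1 / a) ^ ?d)"
  proof (intro tendsto_ennrealI tendsto_mult tendsto_const tendsto_power)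
    have "(\<lambda>n. 1 / a + ((h + m) / a + 1 / 2) * (1 / real n)) \<longlonglongrightarrow> 1 / a + ((h + m) / a + 1 / 2) * 0"
      by (intro tendsto_intros lim_1_over_n)
    moreover have "\<forall>\<^sub>F n in sequentially. 1 / a + ((h + m) / a + 1 / 2) * (1 / real n) = (2 * M (real n) + 1) / (2 * real n)"
      using eventually_gt_at_top[of 0] by eventually_elim (use a in \<open>simp add: M_def field_simps\<close>)
    ultimately show "(\<lambda>n. (2 * M (real n) + 1) / (2 * real n)) \<longlonglongrightarrow> 1 / a"
      by (simp add: tendsto_cong)
  qed
  have "Theta TYPE('a) \<le> covering_density C h"
    unfolding Theta_def using cC h covC by (intro INF_lower2[of "(C, h)"]) auto
  also have "\<dots> \<le> liminf (\<lambda>n. ennreal (real (card \<xi>) * V * ((2 * M (real n) + 1) / (2 * real n)) ^ ?d))"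
    unfolding covering_density_def cube_def[symmetric]
    by (intro Liminf_mono eventually_mono[OF eventually_gt_at_top[of 0]] bound) simp
  also have "\<dots> = ennreal (real (card \<xi>) * V * (1 / a) ^ ?d)"
    by (rule lim_imp_Liminf[OF _ lim]) simp
  finally show ?thesis by (simp add: V_def power_divide)
qed

text \<open>\<open>enn2real\<close> sends infinity to 0, so finiteness is what lets
  \<open>Theta\<close> be replaced by a real number. Any finite covering of one cube
  suffices.\<close>

lemma Theta_finite: "Theta TYPE('a::euclidean_space) < \<infinity>"
proof -
  have "seq_compact (cbox 0 (1 *\<^sub>R One) :: 'a set)" by (intro compact_imp_seq_compact compact_cbox)
  from seq_compact_imp_totally_bounded[OF this, rule_format, of 1]
  obtain \<xi> where \<xi>: "finite \<xi>" "cbox 0 (1 *\<^sub>R One) \<subseteq> (\<Union>c\<in>\<xi>. ball (c::'a) 1)"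
    by auto
  have "cbox 0 (1 *\<^sub>R One) \<subseteq> (\<Union>c\<in>\<xi>. cball (c::'a) 1)"
    using ball_subset_cball by (intro order_trans[OF \<xi>(2)] UN_mono) auto
  from Theta_le_cube_covering[OF \<xi>(1) _ _ this]
  have "Theta TYPE('a) \<le> ennreal (real (card \<xi>) * (unit_ball_vol (real DIM('a)) * 1 ^ DIM('a)) / 1 ^ DIM('a))"
    by simp
  then show ?thesis by (rule le_less_trans) simp
qed

section \<open>Lower bound for covering numbers\<close>

text \<open>The side a of the test cube is fixed before h: small enough that the admissible
  positions lose little measure. The relative width of the margin around the cube then tends to 0
  with h, and the threshold for h is the same for all node sets.\<close>

lemma covering_number_lower:
  fixes \<Omega> :: "'a::euclidean_space set"
  assumes conv: "convex \<Omega>" and comp: "compact \<Omega>"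
    and G: "G < enn2real (Theta TYPE('a)) * measure lborel \<Omega> / unit_ball_vol (real DIM('a))"
  shows "\<forall>\<^sub>F h in at_right 0. \<forall>\<xi>. finite \<xi> \<longrightarrow> \<Omega> \<subseteq> (\<Union>c\<in>\<xi>. cball c h) \<longrightarrow> G < real (card \<xi>) * h ^ DIM('a)"
proof -
  let ?d = "DIM('a)" and ?\<nu> = "unit_ball_vol (real DIM('a))"
  define \<theta> where "\<theta> = enn2real (Theta TYPE('a))"
  have \<theta>: "Theta TYPE('a) = ennreal \<theta>" "\<theta> \<ge> 0"
    using Theta_finite[where 'a='a] by (auto simp: \<theta>_def)
  have \<nu>: "?\<nu> > 0" by simp
  then have \<nu>0: "?\<nu> \<noteq> 0" by linarith
  \<comment> \<open>The erosion of \<Omega> by the cube of side a; as a decreases it exhausts the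
    interior of \<Omega>.\<close>
  define T where "T a = (\<Inter>v\<in>cbox 0 (a *\<^sub>R One). (\<lambda>t. t + v) -` \<Omega>)" for a
  have clT: "closed (T a)" for a
    unfolding T_def using compact_imp_closed[OF comp]
    by (intro closed_INT ballI closed_vimage) (auto intro!: continuous_intros)
  have subT: "T a \<subseteq> \<Omega>" if "a \<ge> 0" for a
  proof
    fix t assume t: "t \<in> T a"
    have "(0::'a) \<in> cbox 0 (a *\<^sub>R One)" using that by (simp add: mem_box)
    then have "t + 0 \<in> \<Omega>" using t unfolding T_def by blast
    then show "t \<in> \<Omega>" by simp
  qed
  have fin\<Omega>: "emeasure lborel \<Omega> < \<infinity>" by (rule emeasure_compact_finite[OF comp])
  have finT: "emeasure lborel (T a) < \<infinity>" if "a \<ge> 0" for a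
    using emeasure_mono[OF subT[OF that], of lborel] fin\<Omega> compact_imp_closed[OF comp]
    by (simp add: borel_closed le_less_trans)
  obtain a where a: "a > 0" "G < \<theta> * measure lborel (T a) / ?\<nu>"
  proof -
    define A where "A n = T (inverse (real (Suc n)))" for n
    have sub: "interior \<Omega> \<subseteq> (\<Union>n. A n)"
    proof
      fix t assume "t \<in> interior \<Omega>"
      then obtain e where e: "e > 0" "ball t e \<subseteq> \<Omega>" using mem_interior by blast
      obtain n where n: "inverse (real (Suc n)) < e / (real ?d + 1)"
        using reals_Archimedean[of "e / (real ?d + 1)"] e by auto
      let ?a = "inverse (real (Suc n))"
      have "t + v \<in> \<Omega>" if v: "v \<in> cbox 0 (?a *\<^sub>R One)" for v
      proof -
        have "norm v \<le> (\<Sum>i\<in>Basis. \<bar>v \<bullet> i\<bar>)" by (rule norm_le_l1)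
        also have "\<dots> \<le> (\<Sum>i\<in>(Basis::'a set). ?a)" using v by (intro sum_mono) (auto simp: mem_box)
        also have "\<dots> = real ?d * ?a" by simp
        also have "\<dots> \<le> (real ?d + 1) * ?a" by (intro mult_right_mono) auto
        also have "\<dots> < e" using n by (simp add: field_simps)
        finally show ?thesis using e by (auto simp: dist_norm)
      qed
      then have "t \<in> A n" by (auto simp: A_def T_def)
      then show "t \<in> (\<Union>n. A n)" by blast
    qed
    have "A n \<subseteq> \<Omega>" for n unfolding A_def by (rule subT) simp
    then have sub2: "(\<Union>n. A n) \<subseteq> \<Omega>" by blast
    have sets: "range A \<subseteq> sets lborel" using clT by (auto simp: A_def borel_closed)
    have "incseq A"
    proof (rule incseq_SucI)
      fix n
      have "cbox 0 (inverse (real (Suc (Suc n))) *\<^sub>R One) \<subseteq> cbox 0 (inverse (real (Suc n)) *\<^sub>R (One::'a))"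
        by (auto simp: subset_box field_simps)
      then show "A n \<subseteq> A (Suc n)" unfolding A_def T_def by blast
    qed
    moreover have "emeasure lborel (\<Union>n. A n) < \<infinity>"
      using emeasure_mono[OF sub2, of lborel] fin\<Omega> compact_imp_closed[OF comp] by (simp add: borel_closed le_less_trans)
    ultimately have "(\<lambda>n. measure lborel (A n)) \<longlonglongrightarrow> measure lborel (\<Union>n. A n)"
      using sets by (intro Lim_measure_incseq) auto
    moreover have "measure lborel (\<Union>n. A n) = measure lborel \<Omega>"
    proof (rule antisym)
      show "measure lborel (\<Union>n. A n) \<le> measure lborel \<Omega>"
        using sub2 fin\<Omega> sets compact_imp_closed[OF comp]
        by (intro measure_mono_fmeasurable) (auto simp: fmeasurable_def borel_closed)
      \<comment> \<open>Convexity enters here: the frontier is negligible, so the interior has full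
        measure.\<close>
      have "measure lborel (interior \<Omega>) = measure lborel \<Omega>"
        using measure_interior[of \<Omega>] negligible_convex_frontier[OF conv] compact_imp_bounded[OF comp]
          borel_closed[OF compact_imp_closed[OF comp]] borel_open[OF open_interior[of \<Omega>]] by simp
      moreover have "measure lborel (interior \<Omega>) \<le> measure lborel (\<Union>n. A n)"
        using sub \<open>emeasure lborel (\<Union>n. A n) < \<infinity>\<close> sets
        by (intro measure_mono_fmeasurable) (auto simp: fmeasurable_def)
      ultimately show "measure lborel \<Omega> \<le> measure lborel (\<Union>n. A n)" by simp
    qed
    ultimately have "(\<lambda>n. measure lborel (A n)) \<longlonglongrightarrow> measure lborel \<Omega>" by simp
    then have "(\<lambda>n. \<theta> * measure lborel (A n) / ?\<nu>) \<longlonglongrightarrow> \<theta> * measure lborel \<Omega> / ?\<nu>"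
      by (intro tendsto_intros \<nu>0)
    then have "\<forall>\<^sub>F n in sequentially. G < \<theta> * measure lborel (A n) / ?\<nu>"
      using G unfolding \<theta>_def by (rule order_tendstoD)
    then obtain n where "G < \<theta> * measure lborel (A n) / ?\<nu>" by (auto simp: eventually_sequentially)
    then show ?thesis using that[of "inverse (real (Suc n))"] by (simp add: A_def)
  qed
  have "((\<lambda>h. \<theta> * measure lborel (T a) / ?\<nu> * (a / (a + 2 * h)) ^ ?d) \<longlongrightarrow>
      \<theta> * measure lborel (T a) / ?\<nu> * (a / (a + 2 * 0)) ^ ?d) (at_right 0)"
    using a by (intro tendsto_intros) auto
  then have "\<forall>\<^sub>F h in at_right 0. G < \<theta> * measure lborel (T a) / ?\<nu> * (a / (a + 2 * h)) ^ ?d"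
    using a by (intro order_tendstoD) auto
  then show ?thesis
    using eventually_at_right_less[of 0]
  proof eventually_elim
    case (elim h)
    show ?case
    proof (intro allI impI)
      fix \<xi> :: "'a set" assume fin: "finite \<xi>" and cov: "\<Omega> \<subseteq> (\<Union>c\<in>\<xi>. cball c h)"
      have h: "h > 0" using elim by simp
      \<comment> \<open>Relative to t, this contains every centre whose ball meets the cube at
        t.\<close>
      define B where "B = cbox ((-h) *\<^sub>R One) ((a + h) *\<^sub>R (One::'a))"
      \<comment> \<open>The least count that \<open>Theta_le_cube_covering\<close> allows for a cube
        of side a, rounded up because counts are natural numbers.\<close>
      define m where "m = nat \<lceil>\<theta> * a ^ ?d / (?\<nu> * h ^ ?d)\<rceil>"
      have "real m * measure lborel (T a) \<le> real (card \<xi>) * measure lborel B"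
      proof (rule translates_average[OF fin])
        show "B \<in> sets borel" by (simp add: B_def)
        show "emeasure lborel B < \<infinity>" unfolding B_def by (intro emeasure_compact_finite compact_cbox)
        show "T a \<in> sets borel" "emeasure lborel (T a) < \<infinity>" using clT finT a by (auto simp: borel_closed)
        fix t assume t: "t \<in> T a"
        let ?X = "{c \<in> \<xi>. c - t \<in> B}"
        have "cbox 0 (a *\<^sub>R One) \<subseteq> (\<Union>c\<in>(\<lambda>c. c - t) ` ?X. cball c h)"
        proof
          fix v assume v: "v \<in> cbox 0 (a *\<^sub>R (One::'a))"
          then have "t + v \<in> \<Omega>" using t unfolding T_def by blast
          then obtain c where c: "c \<in> \<xi>" "t + v \<in> cball c h" using cov by blast
          have "c - t \<in> B" unfolding B_def mem_scaled_box
          proof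
            fix i :: 'a assume i: "i \<in> Basis"
            have "\<bar>c \<bullet> i - (t + v) \<bullet> i\<bar> \<le> h" by (rule mem_cball_inner[OF c(2) i])
            moreover have "0 \<le> v \<bullet> i" "v \<bullet> i \<le> a" using v i by (auto simp: mem_box)
            ultimately show "- h \<le> (c - t) \<bullet> i \<and> (c - t) \<bullet> i \<le> a + h"
              by (simp add: inner_diff_left inner_add_left abs_le_iff)
          qed
          moreover have "v \<in> cball (c - t) h" using c(2) by (simp add: dist_norm algebra_simps)
          ultimately show "v \<in> (\<Union>c\<in>(\<lambda>c. c - t) ` ?X. cball c h)" using c(1) by blast
        qed
        from Theta_le_cube_covering[OF _ h a(1) this] fin
        have "ennreal \<theta> \<le> ennreal (real (card ((\<lambda>c. c - t) ` ?X)) * (?\<nu> * h ^ ?d) / a ^ ?d)" by (simp add: \<theta>)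
        also have "card ((\<lambda>c. c - t) ` ?X) = card ?X" by (intro card_image inj_onI) simp
        finally have "\<theta> \<le> real (card ?X) * (?\<nu> * h ^ ?d) / a ^ ?d"
          using h a \<nu> by (subst (asm) ennreal_le_iff) auto
        then have "\<theta> * a ^ ?d / (?\<nu> * h ^ ?d) \<le> real (card ?X)"
          using h a \<nu> by (simp add: field_simps)
        then show "m \<le> card ?X" by (simp add: m_def ceiling_le_iff nat_le_iff)
      qed
      also have "measure lborel B = (a + 2 * h) ^ ?d"
        using h a unfolding B_def by (subst measure_scaled_box) (auto simp: algebra_simps)
      finally have "real m * measure lborel (T a) \<le> real (card \<xi>) * (a + 2 * h) ^ ?d" .
      moreover have "\<theta> * a ^ ?d / (?\<nu> * h ^ ?d) \<le> real m" unfolding m_def by (rule real_nat_ceiling_ge)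
      ultimately have "\<theta> * a ^ ?d / (?\<nu> * h ^ ?d) * measure lborel (T a) \<le> real (card \<xi>) * (a + 2 * h) ^ ?d"
        by (meson measure_nonneg mult_right_mono order_trans)
      then have "\<theta> * measure lborel (T a) / ?\<nu> * (a / (a + 2 * h)) ^ ?d \<le> real (card \<xi>) * h ^ ?d"
        using h a \<nu> by (simp add: power_divide field_simps)
      then show "G < real (card \<xi>) * h ^ ?d" using elim by linarith
    qed
  qed
qed

section \<open>Parallel sets of compact sets\<close>

definition nbhd :: "real \<Rightarrow> 'a::euclidean_space set \<Rightarrow> 'a set" where
  "nbhd h A = {x. infdist x A \<le> h}"

lemma compact_nbhd:
  assumes "compact A" "A \<noteq> {}"
  shows "compact (nbhd h A)"
proof -
  have "closed (nbhd h A)"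
    unfolding nbhd_def by (intro closed_Collect_le continuous_intros)
  moreover have "bounded (nbhd h A)"
  proof -
    obtain m where m: "\<And>a. a \<in> A \<Longrightarrow> norm a \<le> m"
      using compact_imp_bounded[OF assms(1)] bounded_iff by blast
    have "norm x \<le> m + h" if "x \<in> nbhd h A" for x
    proof -
      obtain a where a: "a \<in> A" "infdist x A = dist x a"
        using infdist_attains_inf[OF compact_imp_closed[OF assms(1)] assms(2)] by blast
      have "norm x \<le> norm a + dist x a" by (metis dist_norm norm_triangle_sub)
      then show ?thesis using that a m[OF a(1)] by (simp add: nbhd_def)
    qed
    then show ?thesis by (auto simp: bounded_iff)
  qed
  ultimately show ?thesis by (simp add: compact_eq_bounded_closed)
qed

lemma nbhd_mono: "h \<le> h' \<Longrightarrow> nbhd h A \<subseteq> nbhd h' A"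
  by (auto simp: nbhd_def)

lemma measure_nbhd_mono:
  assumes "compact A" "A \<noteq> {}" "h \<le> h'"
  shows "measure lborel (nbhd h A) \<le> measure lborel (nbhd h' A)"
  using nbhd_mono[OF assms(3), of A] compact_nbhd[OF assms(1,2)] emeasure_compact_finite
  by (intro measure_mono_fmeasurable) (auto simp: fmeasurable_def borel_compact)

text \<open>Continuity of measure from above, since the parallel sets of a compact set shrink to it.
  For the frontier of a convex body, which has measure 0, it makes additional boundary nodes
  cheap.\<close>

lemma measure_nbhd_small:
  fixes A :: "'a::euclidean_space set"
  assumes A: "compact A" "A \<noteq> {}" and e: "e > 0"
  shows "\<forall>\<^sub>F h in at_right 0. measure lborel (nbhd h A) < measure lborel A + e"
proof -
  define N where "N n = nbhd (inverse (real (Suc n))) A" for n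
  have "(\<Inter>n. N n) = A"
  proof (rule set_eqI)
    fix x
    have "x \<in> (\<Inter>n. N n) \<longleftrightarrow> (\<forall>n. infdist x A \<le> inverse (real (Suc n)))" by (simp add: N_def nbhd_def)
    also have "\<dots> \<longleftrightarrow> infdist x A \<le> 0"
    proof
      assume le: "\<forall>n. infdist x A \<le> inverse (real (Suc n))"
      show "infdist x A \<le> 0"
      proof (rule ccontr)
        assume "\<not> ?thesis"
        then obtain n where "inverse (real (Suc n)) < infdist x A"
          using reals_Archimedean[of "infdist x A"] by auto
        then show False using le[rule_format, of n] by linarith
      qed
    next
      assume "infdist x A \<le> 0"
      moreover have "0 \<le> inverse (real (Suc n))" for n by simp
      ultimately show "\<forall>n. infdist x A \<le> inverse (real (Suc n))" using order_trans by blast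
    qed
    also have "\<dots> \<longleftrightarrow> infdist x A = 0" using infdist_nonneg[of x A] by linarith
    also have "\<dots> \<longleftrightarrow> x \<in> A" using in_closed_iff_infdist_zero[OF compact_imp_closed[OF A(1)] A(2)] by blast
    finally show "x \<in> (\<Inter>n. N n) \<longleftrightarrow> x \<in> A" .
  qed
  moreover have "(\<lambda>n. measure lborel (N n)) \<longlonglongrightarrow> measure lborel (\<Inter>n. N n)"
  proof (rule Lim_measure_decseq)
    show "range N \<subseteq> sets lborel" using compact_nbhd[OF A] by (auto simp: N_def borel_compact)
    show "decseq N" unfolding N_def by (intro decseq_SucI nbhd_mono) (simp add: field_simps)
    show "emeasure lborel (N n) \<noteq> \<infinity>" for n
      using emeasure_compact_finite[OF compact_nbhd[OF A]] unfolding N_def by (metis less_irrefl)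
  qed
  ultimately have "(\<lambda>n. measure lborel (N n)) \<longlonglongrightarrow> measure lborel A" by simp
  from order_tendstoD(2)[OF this, of "measure lborel A + e"] e
  obtain n where n: "measure lborel (N n) < measure lborel A + e" by (auto simp: eventually_sequentially)
  have "\<forall>\<^sub>F h in at_right 0. h \<in> {0<..<inverse (real (Suc n))}"
    by (intro eventually_at_right_real) simp
  then show ?thesis
  proof eventually_elim
    case (elim h)
    then have "measure lborel (nbhd h A) \<le> measure lborel (N n)"
      unfolding N_def by (intro measure_nbhd_mono A) auto
    then show ?case using n by linarith
  qed
qed

section \<open>Upper bound for covering numbers\<close>

text \<open>Dilation changes the radius to h and preserves density. A lower limit below K is
  witnessed by arbitrarily large cubes, not by all, hence the form of the second claim. Balls
  centred in the cube of half-width R lie in that of half-width R + h, so each counts with its full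
  volume.\<close>

lemma economical_covering:
  assumes K: "Theta TYPE('a::euclidean_space) < ennreal K" and h: "h > 0"
  obtains C :: "'a::euclidean_space set" where "(\<Union>c\<in>C. cball c h) = UNIV"
    "\<And>R0. \<exists>R\<ge>R0. finite (C \<inter> cube R) \<and>
        real (card (C \<inter> cube R)) * (unit_ball_vol (real DIM('a)) * h ^ DIM('a)) \<le> K * (2 * (R + h)) ^ DIM('a)"
proof -
  let ?d = "DIM('a)" and ?\<nu> = "unit_ball_vol (real DIM('a))"
  have \<nu>: "?\<nu> > 0" by simp
  obtain C0 :: "'a set" and r where C0: "r > 0" "(\<Union>c\<in>C0. cball c r) = UNIV" "covering_density C0 r < ennreal K"
    using K unfolding Theta_def INF_less_iff by auto
  have K0: "K > 0" using K by (metis ennreal_neg not_less_zero not_le)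
  define \<tau> where "\<tau> = h / r"
  have \<tau>: "\<tau> > 0" "\<tau> * r = h" using h C0(1) by (auto simp: \<tau>_def)
  define C where "C = (\<lambda>x. \<tau> *\<^sub>R x) ` C0"
  let ?F = "\<lambda>R. (\<integral>\<^sup>+ c. emeasure lborel (cball c r \<inter> cube R) \<partial>count_space C0)"
  have cov: "(\<Union>c\<in>C. cball c h) = UNIV"
  proof (rule UNIV_eq_I[symmetric])
    fix x :: 'a
    obtain c where c: "c \<in> C0" "dist c (x /\<^sub>R \<tau>) \<le> r" using C0(2) by (metis UNIV_I UN_E mem_cball)
    have "dist (\<tau> *\<^sub>R c) (\<tau> *\<^sub>R (x /\<^sub>R \<tau>)) = \<tau> * dist c (x /\<^sub>R \<tau>)"
      using \<tau>(1) by (simp only: dist_norm scaleR_diff_right[symmetric] norm_scaleR abs_of_pos)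
    also have "\<dots> \<le> \<tau> * r" using c(2) \<tau>(1) by (intro mult_left_mono) auto
    finally have "x \<in> cball (\<tau> *\<^sub>R c) h" using \<tau> by simp
    then show "x \<in> (\<Union>c\<in>C. cball c h)" using c(1) by (auto simp: C_def)
  qed
  have "\<exists>R\<ge>R0. finite (C \<inter> cube R) \<and> real (card (C \<inter> cube R)) * (?\<nu> * h ^ ?d) \<le> K * (2 * (R + h)) ^ ?d" for R0
  proof -
    have "\<not> (\<forall>\<^sub>F n in sequentially. ennreal K \<le> ?F (real n) / emeasure lborel (cube (real n) :: 'a set))"
    proof
      assume "\<forall>\<^sub>F n in sequentially. ennreal K \<le> ?F (real n) / emeasure lborel (cube (real n) :: 'a set)"
      then have "ennreal K \<le> covering_density C0 r"
        unfolding covering_density_def cube_def[symmetric] by (rule Liminf_bounded)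
      then show False using C0(3) by simp
    qed
    then obtain n where n: "n \<ge> nat \<lceil>r + R0 / \<tau>\<rceil> + 1"
      "?F (real n) / emeasure lborel (cube (real n) :: 'a set) < ennreal K"
      unfolding eventually_sequentially by (meson not_le)
    have n0: "real n > 0" using n(1) by simp
    have nR: "r + R0 / \<tau> \<le> real n" using n(1) by linarith
    have "?F (real n) < ennreal K * ennreal ((2 * real n) ^ ?d)"
      using n(2) n0 by (simp add: emeasure_cube divide_less_ennreal)
    then have Fn: "?F (real n) < ennreal (K * (2 * real n) ^ ?d)"
      using K0 by (simp add: ennreal_mult')
    define D where "D = C0 \<inter> cube (real n - r)"
    have "ennreal (?\<nu> * r ^ ?d) * emeasure (count_space C0) D = (\<integral>\<^sup>+ c. ennreal (?\<nu> * r ^ ?d) * indicator D c \<partial>count_space C0)"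
      by (subst nn_integral_cmult_indicator) (auto simp: D_def)
    also have "\<dots> \<le> ?F (real n)"
    proof (rule nn_integral_mono)
      fix c
      have "ennreal (?\<nu> * r ^ ?d) \<le> emeasure lborel (cball c r \<inter> cube (real n))" if c: "c \<in> D"
      proof -
        have "cball c r \<subseteq> cube (real n)"
        proof
          fix x assume x: "x \<in> cball c r"
          show "x \<in> cube (real n)" unfolding mem_cube
          proof
            fix i :: 'a assume i: "i \<in> Basis"
            have "\<bar>c \<bullet> i\<bar> \<le> real n - r" using c i by (auto simp: D_def mem_cube)
            then show "\<bar>x \<bullet> i\<bar> \<le> real n" using mem_cball_inner[OF x i] by linarith
          qed
        qed
        then have "cball c r \<inter> cube (real n) = cball c r" by blast
        then show ?thesis using C0(1) by (simp add: emeasure_cball)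
      qed
      then show "ennreal (?\<nu> * r ^ ?d) * indicator D c \<le> emeasure lborel (cball c r \<inter> cube (real n))"
        by (cases "c \<in> D") auto
    qed
    also note Fn
    finally have lt: "ennreal (?\<nu> * r ^ ?d) * emeasure (count_space C0) D < ennreal (K * (2 * real n) ^ ?d)" .
    have pos: "?\<nu> * r ^ ?d > 0" using \<nu> C0(1) by (intro mult_pos_pos zero_less_power)
    \<comment> \<open>A covering is only required to be countable, so its centres might accumulate;
      an infinite set here would make the integral infinite.\<close>
    have finD: "finite D"
    proof (rule ccontr)
      assume "infinite D"
      then have "emeasure (count_space C0) D = \<infinity>" by (simp add: emeasure_count_space_infinite D_def)
      then show False using lt \<nu> C0(1) less_imp_neq[OF \<nu>] by (simp add: ennreal_mult_top)
    qed
    then have "emeasure (count_space C0) D = of_nat (card D)" by (intro emeasure_count_space_finite) (auto simp: D_def)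
    then have "ennreal (?\<nu> * r ^ ?d * real (card D)) < ennreal (K * (2 * real n) ^ ?d)"
      using lt pos by (simp add: ennreal_mult'' ennreal_of_nat_eq_real_of_nat)
    then have cD: "?\<nu> * r ^ ?d * real (card D) < K * (2 * real n) ^ ?d"
      using pos by (subst (asm) ennreal_less_iff) auto
    define R where "R = \<tau> * (real n - r)"
    have RR: "R0 \<le> R" using nR \<tau>(1) by (simp add: R_def field_simps)
    have im: "C \<inter> cube R \<subseteq> (\<lambda>x. \<tau> *\<^sub>R x) ` D"
    proof
      fix y assume "y \<in> C \<inter> cube R"
      then obtain x where x: "x \<in> C0" "y = \<tau> *\<^sub>R x" "y \<in> cube R" by (auto simp: C_def)
      have "x \<in> cube (real n - r)" unfolding mem_cube
      proof
        fix i :: 'a assume "i \<in> Basis"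
        then have "\<bar>\<tau> * (x \<bullet> i)\<bar> \<le> \<tau> * (real n - r)" using x(2,3) by (auto simp: mem_cube R_def)
        then show "\<bar>x \<bullet> i\<bar> \<le> real n - r" using \<tau>(1) by (simp add: abs_mult)
      qed
      then show "y \<in> (\<lambda>x. \<tau> *\<^sub>R x) ` D" using x by (auto simp: D_def)
    qed
    have fin: "finite (C \<inter> cube R)" using finite_subset[OF im] finD by blast
    have "card (C \<inter> cube R) \<le> card D"
      using card_mono[OF _ im] card_image_le[OF finD, of "\<lambda>x. \<tau> *\<^sub>R x"] finD by (meson finite_imageI order_trans)
    then have "real (card (C \<inter> cube R)) * (?\<nu> * h ^ ?d) \<le> real (card D) * (?\<nu> * h ^ ?d)"
      using h \<nu> by (intro mult_right_mono) auto
    also have "\<dots> = (?\<nu> * r ^ ?d * real (card D)) * \<tau> ^ ?d"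
      unfolding \<tau>(2)[symmetric] by (simp add: power_mult_distrib mult_ac)
    also have "\<dots> \<le> (K * (2 * real n) ^ ?d) * \<tau> ^ ?d"
      using cD \<tau>(1) by (intro mult_right_mono) auto
    also have "\<dots> = K * (2 * (R + h)) ^ ?d"
      unfolding R_def \<tau>(2)[symmetric] by (simp add: power_mult_distrib algebra_simps)
    finally show ?thesis using fin RR by blast
  qed
  then show ?thesis using that cov by blast
qed

text \<open>Compactness of A alone is assumed so that the frontier of \<Omega> can be covered by the
  same lemma. A ball of radius h that meets A has its centre in \<open>nbhd h A\<close>, so only the
  centres there have to be counted.\<close>

lemma covering_number_upper:
  fixes A :: "'a::euclidean_space set"
  assumes A: "compact A" "A \<noteq> {}" and h: "h > 0" and K: "Theta TYPE('a) < ennreal K"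
  obtains \<xi> where "finite \<xi>" "A \<subseteq> (\<Union>c\<in>\<xi>. cball c h)"
    "real (card \<xi>) * (unit_ball_vol (real DIM('a)) * h ^ DIM('a)) \<le> K * measure lborel (nbhd h A)"
proof -
  let ?d = "DIM('a)" and ?\<nu> = "unit_ball_vol (real DIM('a))"
  \<comment> \<open>The gap between K' and K absorbs the factor
    \<open>((R + h) / (R - m))^d\<close>, which tends to 1 as R grows.\<close>
  obtain K' where K': "Theta TYPE('a) < ennreal K'" "K' < K" "K' > 0"
  proof -
    obtain z where z: "Theta TYPE('a) < z" "z < ennreal K" using dense[OF K] by blast
    then obtain k where k: "z = ennreal k" "k \<ge> 0" by (cases z) auto
    have "k < K" using z(2) k by (metis ennreal_leI not_le)
    moreover have "k \<noteq> 0" using z(1) k by auto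
    ultimately show ?thesis using that[of k] z k by auto
  qed
  obtain C :: "'a set" where C: "(\<Union>c\<in>C. cball c h) = UNIV"
    "\<And>R0. \<exists>R\<ge>R0. finite (C \<inter> cube R) \<and>
        real (card (C \<inter> cube R)) * (?\<nu> * h ^ ?d) \<le> K' * (2 * (R + h)) ^ ?d"
    using economical_covering[OF K'(1) h] by blast
  define V where "V = ?\<nu> * h ^ ?d"
  have V: "V > 0" unfolding V_def using h by (intro mult_pos_pos zero_less_power) simp_all
  let ?B = "nbhd h A"
  have cB: "compact ?B" by (rule compact_nbhd[OF A])
  obtain m where m: "m > 0" "\<And>b. b \<in> ?B \<Longrightarrow> norm b \<le> m"
    using compact_imp_bounded[OF cB] bounded_pos by blast
  have "((\<lambda>R. K' * ((1 + h * inverse R) / (1 - m * inverse R)) ^ ?d) \<longlongrightarrow> K' * ((1 + h * 0) / (1 - m * 0)) ^ ?d) at_top"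
    by (intro tendsto_intros tendsto_inverse_0_at_top filterlim_ident) auto
  then have "\<forall>\<^sub>F R in at_top. K' * ((1 + h * inverse R) / (1 - m * inverse R)) ^ ?d < K"
    using K'(2) by (intro order_tendstoD(2)) auto
  then obtain R1 where R1: "\<And>R. R \<ge> R1 \<Longrightarrow> K' * ((1 + h * inverse R) / (1 - m * inverse R)) ^ ?d < K"
    by (auto simp: eventually_at_top_linorder)
  obtain R where R: "R \<ge> max R1 (m + 1)" "finite (C \<inter> cube R)" "real (card (C \<inter> cube R)) * V \<le> K' * (2 * (R + h)) ^ ?d"
    using C(2)[of "max R1 (m + 1)"] unfolding V_def by blast
  have Rm: "R > m" "R > 0" using R(1) m(1) by auto
  have ratio: "K' * (R + h) ^ ?d \<le> K * (R - m) ^ ?d"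
  proof -
    have "(1 + h * inverse R) / (1 - m * inverse R) = (R + h) / (R - m)"
      using Rm by (simp add: field_simps)
    then have "K' * ((R + h) / (R - m)) ^ ?d < K" using R1[of R] R(1) by simp
    then show ?thesis using Rm by (simp add: power_divide field_simps)
  qed
  define X where "X = C \<inter> cube R"
  let ?f = "\<lambda>t. card {c \<in> X. c - t \<in> ?B}"
  \<comment> \<open>These shifts keep the parallel set, whose points have norm at most m, inside the
    cube of half-width R in which the centres have been counted.\<close>
  define T :: "'a set" where "T = cube (R - m)"
  have "0 \<in> T" using Rm by (simp add: T_def mem_cube)
  \<comment> \<open>The count is a natural number, so its minimum is attained; the minimum is then
    the lower count in \<open>translates_average\<close>.\<close>
  then have "\<exists>t. t \<in> T \<and> (\<forall>s. s \<in> T \<longrightarrow> ?f t \<le> ?f s)"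
    by (rule ex_has_least_nat)
  then obtain t where t: "t \<in> T" "\<And>s. s \<in> T \<Longrightarrow> ?f t \<le> ?f s" by blast
  have "real (?f t) * measure lborel T \<le> real (card X) * measure lborel ?B"
  proof (rule translates_average)
    show "finite X" using R(2) by (simp add: X_def)
    show "?B \<in> sets borel" using cB by (rule borel_compact)
    show "emeasure lborel ?B < \<infinity>" using cB by (rule emeasure_compact_finite)
    show "T \<in> sets borel" by (simp add: T_def)
    show "emeasure lborel T < \<infinity>" unfolding T_def by (intro emeasure_compact_finite compact_cube)
  qed (rule t(2))
  then have avg: "real (?f t) * (2 * (R - m)) ^ ?d \<le> real (card X) * measure lborel ?B"
    using Rm by (simp add: T_def measure_cube)
  define \<xi> where "\<xi> = (\<lambda>c. c - t) ` {c \<in> X. c - t \<in> ?B}"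
  have finX: "finite X" using R(2) by (simp add: X_def)
  then have fin: "finite \<xi>" by (simp add: \<xi>_def)
  have card: "card \<xi> = ?f t" unfolding \<xi>_def by (intro card_image inj_onI) simp
  have cov: "A \<subseteq> (\<Union>c\<in>\<xi>. cball c h)"
  proof
    fix x assume x: "x \<in> A"
    obtain c where c: "c \<in> C" "dist c (x + t) \<le> h" using C(1) by (metis UNIV_I UN_E mem_cball)
    have d: "dist (c - t) x \<le> h" using c(2) by (simp add: dist_norm algebra_simps)
    have "infdist (c - t) A \<le> h" using infdist_le[OF x, of "c - t"] d by linarith
    then have cB': "c - t \<in> ?B" by (simp add: nbhd_def)
    have "c \<in> cube R" unfolding mem_cube
    proof
      fix i :: 'a assume i: "i \<in> Basis"
      have "\<bar>(c - t) \<bullet> i\<bar> \<le> m" using m(2)[OF cB'] Basis_le_norm[OF i, of "c - t"] by linarith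
      moreover have "\<bar>t \<bullet> i\<bar> \<le> R - m" using t(1) i by (auto simp: T_def mem_cube)
      ultimately show "\<bar>c \<bullet> i\<bar> \<le> R" unfolding inner_diff_left by linarith
    qed
    then have "c - t \<in> \<xi>" using c(1) cB' by (auto simp: \<xi>_def X_def)
    then show "x \<in> (\<Union>c\<in>\<xi>. cball c h)" using d by auto
  qed
  have "real (card \<xi>) * V * (2 * (R - m)) ^ ?d = (real (?f t) * (2 * (R - m)) ^ ?d) * V" by (simp add: card)
  also have "\<dots> \<le> (real (card X) * measure lborel ?B) * V" using avg V by (intro mult_right_mono) auto
  also have "\<dots> = (real (card X) * V) * measure lborel ?B" by simp
  also have "\<dots> \<le> (K' * (2 * (R + h)) ^ ?d) * measure lborel ?B" using R(3) by (intro mult_right_mono) (auto simp: X_def)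
  also have "\<dots> = 2 ^ ?d * (K' * (R + h) ^ ?d) * measure lborel ?B" by (simp only: power_mult_distrib mult_ac)
  also have "\<dots> \<le> 2 ^ ?d * (K * (R - m) ^ ?d) * measure lborel ?B"
    using ratio by (intro mult_right_mono mult_left_mono) auto
  also have "\<dots> = (K * measure lborel ?B) * (2 * (R - m)) ^ ?d" by (simp only: power_mult_distrib mult_ac)
  finally have "real (card \<xi>) * V \<le> K * measure lborel ?B"
    using Rm by (subst (asm) mult_le_cancel_right_pos) auto
  then show ?thesis using that[OF fin cov] by (simp add: V_def)
qed

section \<open>Nodes for the upper bound\<close>

text \<open>Covering the frontier with radius h/2 costs a factor 2^d per unit of measure, but only
  for a parallel set of a null set, so it disappears in the limit.\<close>

lemma good_nodes:
  fixes \<Omega> :: "'a::euclidean_space set"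
  assumes conv: "convex \<Omega>" and comp: "compact \<Omega>" and ne: "\<Omega> \<noteq> {}"
    and G: "enn2real (Theta TYPE('a)) * measure lborel \<Omega> / unit_ball_vol (real DIM('a)) < G"
  shows "\<forall>\<^sub>F h in at_right 0. \<exists>\<xi>. finite \<xi> \<and> \<xi> \<subseteq> \<Omega> \<and> real (card \<xi>) * h ^ DIM('a) \<le> G \<and>
      (\<forall>x\<in>\<Omega>. \<exists>z\<in>\<xi>. dist x z \<le> h) \<and> (\<forall>x\<in>frontier \<Omega>. \<exists>z\<in>\<xi>. dist x z \<le> h / 2)"
proof -
  let ?d = "DIM('a)" and ?\<nu> = "unit_ball_vol (real DIM('a))" and ?\<mu> = "measure lborel \<Omega>"
  define \<theta> where "\<theta> = enn2real (Theta TYPE('a))"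
  have \<theta>: "Theta TYPE('a) = ennreal \<theta>" "\<theta> \<ge> 0"
    using Theta_finite[where 'a='a] by (auto simp: \<theta>_def)
  have \<nu>: "?\<nu> > 0" by simp
  have G': "\<theta> * ?\<mu> < G * ?\<nu>" using G \<nu> unfolding \<theta>_def by (simp add: pos_divide_less_eq)
  \<comment> \<open>With this choice \<epsilon> \<mu> uses at most half of the gap between \<theta>
    \<mu> and G \<nu>; the summand 1 makes the denominator positive.\<close>
  define \<epsilon> where "\<epsilon> = (G * ?\<nu> - \<theta> * ?\<mu>) / (2 * (?\<mu> + 1))"
  define K where "K = \<theta> + \<epsilon>"
  have \<mu>0: "?\<mu> \<ge> 0" by simp
  have den1: "2 * (?\<mu> + 1) > 0" by (intro mult_pos_pos add_nonneg_pos) simp_all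
  have \<epsilon>: "\<epsilon> > 0" unfolding \<epsilon>_def by (rule divide_pos_pos[OF _ den1]) (use G' in linarith)
  have K0: "K > 0" and KT: "Theta TYPE('a) < ennreal K" using \<epsilon> \<theta> by (auto simp: K_def ennreal_less_iff)
  have KG: "K * ?\<mu> < G * ?\<nu>"
  proof -
    from iffD1[OF nonzero_eq_divide_eq[OF less_imp_neq[OF den1, symmetric]] \<epsilon>_def]
    have "2 * (\<epsilon> * ?\<mu>) + 2 * \<epsilon> = G * ?\<nu> - \<theta> * ?\<mu>" by (simp add: algebra_simps)
    moreover have "\<epsilon> * ?\<mu> \<ge> 0" using \<epsilon> \<mu>0 by simp
    ultimately show ?thesis using \<epsilon> unfolding K_def distrib_right by linarith
  qed
  \<comment> \<open>The solution of K (\<mu> + e) + 2^d K e = G \<nu>, whose left side bounds the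
    joint cost of the two coverings.\<close>
  define e where "e = (G * ?\<nu> - K * ?\<mu>) / (K * (1 + 2 ^ ?d))"
  have den: "K * (1 + 2 ^ ?d) > 0" using K0 by (intro mult_pos_pos add_pos_pos) auto
  have e: "e > 0" unfolding e_def using KG den by simp
  have eG: "K * (?\<mu> + e) + 2 ^ ?d * (K * e) = G * ?\<nu>"
  proof -
    have "e * (K * (1 + 2 ^ ?d)) = G * ?\<nu> - K * ?\<mu>"
      by (rule iffD1[OF nonzero_eq_divide_eq[OF less_imp_neq[OF den, symmetric]] e_def])
    then show ?thesis by (simp add: algebra_simps)
  qed
  have cF: "compact (frontier \<Omega>)" using comp by (rule compact_frontier)
  have neF: "frontier \<Omega> \<noteq> {}"
    using ne compact_imp_bounded[OF comp] not_bounded_UNIV by (metis frontier_eq_empty)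
  have "measure lborel (frontier \<Omega>) = measure lebesgue (frontier \<Omega>)"
    using borel_compact[OF cF] by (simp add: measure_completion)
  then have F0: "measure lborel (frontier \<Omega>) = 0"
    using negligible_convex_frontier[OF conv] negligible_imp_measure0 by metis
  have "\<forall>\<^sub>F h in at_right 0. measure lborel (nbhd h (frontier \<Omega>)) < 0 + e"
    using measure_nbhd_small[OF cF neF e] F0 by simp
  then show ?thesis
    using measure_nbhd_small[OF comp ne e] eventually_at_right_less[of 0]
  proof eventually_elim
    case (elim h)
    then have h: "h > 0" by simp
    obtain \<xi>1 where \<xi>1: "finite \<xi>1" "\<Omega> \<subseteq> (\<Union>c\<in>\<xi>1. cball c h)"
      "real (card \<xi>1) * (?\<nu> * h ^ ?d) \<le> K * measure lborel (nbhd h \<Omega>)"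
      using covering_number_upper[OF comp ne h KT] by blast
    obtain \<xi>2 where \<xi>2: "finite \<xi>2" "frontier \<Omega> \<subseteq> (\<Union>c\<in>\<xi>2. cball c (h / 2))"
      "real (card \<xi>2) * (?\<nu> * (h / 2) ^ ?d) \<le> K * measure lborel (nbhd (h / 2) (frontier \<Omega>))"
      using covering_number_upper[OF cF neF _ KT, of "h / 2"] h by auto
    define \<xi> where "\<xi> = closest_point \<Omega> ` (\<xi>1 \<union> \<xi>2)"
    have cl: "closed \<Omega>" using comp by (rule compact_imp_closed)
    have proj: "dist x (closest_point \<Omega> c) \<le> dist x c" if "x \<in> \<Omega>" for x c
      using closest_point_lipschitz[OF conv cl ne, of x c] closest_point_self[OF that] by simp
    have "finite \<xi>" using \<xi>1(1) \<xi>2(1) by (simp add: \<xi>_def)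
    moreover have "\<xi> \<subseteq> \<Omega>" using closest_point_in_set[OF cl ne] by (auto simp: \<xi>_def)
    moreover have "\<exists>z\<in>\<xi>. dist x z \<le> h" if x: "x \<in> \<Omega>" for x
    proof -
      obtain c where c: "c \<in> \<xi>1" "dist x c \<le> h" using \<xi>1(2) x by (auto simp: dist_commute)
      have "dist x (closest_point \<Omega> c) \<le> h" using proj[OF x, of c] c(2) by linarith
      then show ?thesis using c(1) by (auto simp: \<xi>_def)
    qed
    moreover have "\<exists>z\<in>\<xi>. dist x z \<le> h / 2" if x: "x \<in> frontier \<Omega>" for x
    proof -
      obtain c where c: "c \<in> \<xi>2" "dist x c \<le> h / 2" using \<xi>2(2) x by (fastforce simp: dist_commute)
      have "x \<in> \<Omega>" using x frontier_subset_closed[OF cl] by blast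
      then have "dist x (closest_point \<Omega> c) \<le> h / 2" using proj[of x c] c(2) by linarith
      then show ?thesis using c(1) by (auto simp: \<xi>_def)
    qed
    moreover have "real (card \<xi>) * h ^ ?d \<le> G"
    proof -
      have "card \<xi> \<le> card \<xi>1 + card \<xi>2"
        unfolding \<xi>_def using \<xi>1(1) \<xi>2(1) by (meson card_Un_le card_image_le finite_UnI order_trans)
      then have "real (card \<xi>) \<le> real (card \<xi>1) + real (card \<xi>2)" by linarith
      then have "real (card \<xi>) * (?\<nu> * h ^ ?d) \<le> (real (card \<xi>1) + real (card \<xi>2)) * (?\<nu> * h ^ ?d)"
        using h \<nu> by (intro mult_right_mono mult_nonneg_nonneg) auto
      also have "\<dots> = real (card \<xi>1) * (?\<nu> * h ^ ?d) + 2 ^ ?d * (real (card \<xi>2) * (?\<nu> * (h / 2) ^ ?d))"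
        by (simp add: power_divide algebra_simps)
      also have "\<dots> \<le> K * (?\<mu> + e) + 2 ^ ?d * (K * e)"
      proof (intro add_mono mult_left_mono)
        show "real (card \<xi>1) * (?\<nu> * h ^ ?d) \<le> K * (?\<mu> + e)"
          using \<xi>1(3) mult_left_mono[of "measure lborel (nbhd h \<Omega>)" "?\<mu> + e" K] elim K0 by linarith
        have "measure lborel (nbhd (h / 2) (frontier \<Omega>)) \<le> e"
          using measure_nbhd_mono[OF cF neF, of "h / 2" h] h elim by linarith
        then show "real (card \<xi>2) * (?\<nu> * (h / 2) ^ ?d) \<le> K * e"
          using \<xi>2(3) mult_left_mono[of "measure lborel (nbhd (h / 2) (frontier \<Omega>))" e K] K0 by linarith
      qed auto
      finally have "(real (card \<xi>) * h ^ ?d) * ?\<nu> \<le> G * ?\<nu>" unfolding eG by (simp only: mult_ac)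
      then show ?thesis using \<nu> by (subst (asm) mult_le_cancel_right_pos) auto
    qed
    ultimately show ?case by blast
  qed
qed

section \<open>The asymptotic formula\<close>

text \<open>The step h solves n h^d = G. Since G limits the cost \<open>card * h^d\<close> of a node
  set, at this step size the limit reads card \<le> n.\<close>

lemma step_size:
  fixes G :: real and d n :: nat
  assumes "G > 0" "d > 0" "n > 0"
  defines "h \<equiv> (G / real n) powr (1 / real d)"
  shows "h > 0" "h ^ d = G / real n" "real n powr (2 / real d) * h\<^sup>2 = G powr (2 / real d)"
proof -
  have pos: "G / real n > 0" using assms by simp
  show h0: "h > 0" unfolding h_def using assms(1,3) by simp
  have "h ^ d = h powr real d" using h0 by (simp add: powr_realpow)
  also have "\<dots> = (G / real n) powr (1 / real d * real d)" by (simp only: h_def powr_powr)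
  also have "\<dots> = G / real n" using assms(1,2) by simp
  finally show "h ^ d = G / real n" .
  have "h\<^sup>2 = h powr 2" using h0 by simp
  also have "\<dots> = (G / real n) powr (1 / real d * 2)" by (simp only: h_def powr_powr)
  finally have "h\<^sup>2 = (G / real n) powr (2 / real d)" by simp
  then show "real n powr (2 / real d) * h\<^sup>2 = G powr (2 / real d)"
    using assms by (simp add: powr_divide)
qed

lemma step_size_tendsto:
  fixes G :: real and d :: nat
  assumes "G > 0" "d > 0"
  shows "filterlim (\<lambda>n. (G / real n) powr (1 / real d)) (at_right 0) sequentially"
proof -
  have "(\<lambda>n. G * (1 / real n)) \<longlonglongrightarrow> G * 0" by (intro tendsto_intros lim_1_over_n)
  then have "(\<lambda>n. G / real n) \<longlonglongrightarrow> 0" by simp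
  then have "(\<lambda>n. (G / real n) powr (1 / real d)) \<longlonglongrightarrow> 0"
    using assms by (intro tendsto_zero_powrI[where b="1 / real d"]) (auto intro!: always_eventually)
  moreover have "\<forall>\<^sub>F n in sequentially. (G / real n) powr (1 / real d) \<in> {0<..}"
    using eventually_gt_at_top[of 0] by eventually_elim (use assms in simp)
  ultimately show ?thesis by (simp add: filterlim_at eventually_mono)
qed

theorem theorem2:
  fixes \<Omega> :: "'a::euclidean_space set" and q :: real
  assumes "convex \<Omega>" and "compact \<Omega>" and "interior \<Omega> \<noteq> {}"
  shows "(\<lambda>n. ereal (real n powr (2 / real DIM('a))) * optimal_recovery \<Omega> 0 q n)
           \<longlonglongrightarrow> ereal ((1/4) * (enn2real (Theta TYPE('a)) * measure lborel \<Omega>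
                                   / measure lborel (ball (0::'a) 1)) powr (2 / real DIM('a)))"
proof -
  let ?d = "DIM('a)" and ?\<nu> = "unit_ball_vol (real DIM('a))"
  define \<kappa> where "\<kappa> = enn2real (Theta TYPE('a)) * measure lborel \<Omega> / ?\<nu>"
  define L where "L = (1/4) * \<kappa> powr (2 / real ?d)"
  let ?a = "\<lambda>n. ereal (real n powr (2 / real ?d)) * optimal_recovery \<Omega> 0 q n"
  have ne: "\<Omega> \<noteq> {}" using assms(3) interior_subset by blast
  have \<nu>: "?\<nu> > 0" by simp
  have \<kappa>0: "\<kappa> \<ge> 0" unfolding \<kappa>_def using \<nu> by (intro divide_nonneg_nonneg mult_nonneg_nonneg) auto
  have d: "?d > 0" by simp
  define h where "h G n = (G / real n) powr (1 / real ?d)" for G n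
  \<comment> \<open>The map sending G to (1/4) G^(2/d) carries the cost scale of the covering
    estimates to the scale of the limit; here it is inverted.\<close>
  have G_of: "(4 * y) powr (real ?d / 2) > 0" "(1/4) * ((4 * y) powr (real ?d / 2)) powr (2 / real ?d) = y"
    if "y > 0" for y
    using that by (simp_all add: powr_powr)
  have \<kappa>_of: "\<kappa> = (4 * L) powr (real ?d / 2)"
    using \<kappa>0 by (simp add: L_def powr_powr powr_one')
  have L0: "L \<ge> 0" by (simp add: L_def)
  have hlim: "filterlim (h G) (at_right 0) sequentially" if "G > 0" for G
    unfolding h_def by (rule step_size_tendsto[OF that d])
  have h2lim: "(\<lambda>n. (h G n)\<^sup>2 / 4) \<longlonglongrightarrow> 0" if G: "G > 0" for G
  proof -
    have "h G \<longlonglongrightarrow> 0" using hlim[OF G] by (simp add: filterlim_at)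
    then have "(\<lambda>n. (h G n)\<^sup>2 / 4) \<longlonglongrightarrow> 0\<^sup>2 / 4" by (intro tendsto_intros) auto
    then show ?thesis by simp
  qed
  have "?a \<longlonglongrightarrow> ereal L"
  proof (rule order_tendstoI)
    fix y assume y: "y < ereal L"
    show "\<forall>\<^sub>F n in sequentially. y < ?a n"
    proof (cases "y < 0")
      case True
      have "0 \<le> ?a n" for n
        unfolding optimal_recovery_def
        by (intro ereal_0_le_mult INF_greatest recovery_error_nonneg ne) simp
      then show ?thesis using True by (intro always_eventually) (auto intro: less_le_trans)
    next
      case False
      then obtain y0 where y0: "y = ereal y0" "0 \<le> y0" using y by (cases y) auto
      \<comment> \<open>Halfway, because z < L gives G < \<kappa> for the covering estimate and y0 <
        z leaves room for the factor 1 + |q| h^2/4.\<close>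
      define z where "z = (y0 + L) / 2"
      have z: "y0 < z" "z < L" "z > 0" using y y0 by (auto simp: z_def)
      define G where "G = (4 * z) powr (real ?d / 2)"
      have G: "G > 0" "(1/4) * G powr (2 / real ?d) = z" unfolding G_def using G_of[OF z(3)] by auto
      have "G < \<kappa>" unfolding G_def \<kappa>_of using z by (intro powr_less_mono2) auto
      from covering_number_lower[OF assms(1,2) this[unfolded \<kappa>_def]]
      have "\<forall>\<^sub>F n in sequentially. \<forall>\<xi>. finite \<xi> \<longrightarrow> \<Omega> \<subseteq> (\<Union>c\<in>\<xi>. cball c (h G n)) \<longrightarrow> G < real (card \<xi>) * h G n ^ ?d"
        using hlim[OF G(1)] by (rule eventually_compose_filterlim)
      moreover have "(\<lambda>n. z / (1 + \<bar>q\<bar> * ((h G n)\<^sup>2 / 4))) \<longlonglongrightarrow> z / (1 + \<bar>q\<bar> * 0)"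
        by (intro tendsto_intros h2lim G) auto
      then have "\<forall>\<^sub>F n in sequentially. y0 < z / (1 + \<bar>q\<bar> * ((h G n)\<^sup>2 / 4))"
        using z by (intro order_tendstoD) auto
      ultimately show ?thesis using eventually_gt_at_top[of 0]
      proof eventually_elim
        case (elim n)
        note S = step_size[OF G(1) d elim(3), folded h_def]
        let ?v = "((h G n)\<^sup>2 / 4) / (1 + \<bar>q\<bar> * ((h G n)\<^sup>2 / 4))"
        have "ereal ?v \<le> optimal_recovery \<Omega> 0 q n" unfolding optimal_recovery_def
        proof (rule INF_greatest)
          fix \<xi> assume "\<xi> \<in> {\<xi>. finite \<xi> \<and> \<xi> \<subseteq> \<Omega> \<and> card \<xi> \<le> n}"
          then have \<xi>: "finite \<xi>" "\<xi> \<subseteq> \<Omega>" "card \<xi> \<le> n" by auto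
          have "real (card \<xi>) * h G n ^ ?d \<le> G"
            unfolding S(2) using \<xi>(3) elim(3) G(1) by (simp add: field_simps)
          \<comment> \<open>A covering would cost more than G, while n nodes cost at most n h^d =
            G.\<close>
          then have "\<not> \<Omega> \<subseteq> (\<Union>c\<in>\<xi>. cball c (h G n))" using elim(1) \<xi>(1) by force
          then obtain c where c: "c \<in> \<Omega>" "c \<notin> (\<Union>c\<in>\<xi>. cball c (h G n))" by blast
          have "h G n < dist c z" if "z \<in> \<xi>" for z using c(2) that by (auto simp: not_le dist_commute)
          then show "ereal ?v \<le> recovery_error \<Omega> 0 q \<xi>" by (rule recovery_error_ge[OF S(1) c(1) \<xi>(2)])
        qed
        then have "ereal (real n powr (2 / real ?d)) * ereal ?v \<le> ?a n"
          by (intro ereal_mult_left_mono) auto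
        moreover have "real n powr (2 / real ?d) * ?v = z / (1 + \<bar>q\<bar> * ((h G n)\<^sup>2 / 4))"
          using S(3) G(2) by (simp add: field_simps)
        ultimately have "ereal (z / (1 + \<bar>q\<bar> * ((h G n)\<^sup>2 / 4))) \<le> ?a n" by simp
        moreover have "y < ereal (z / (1 + \<bar>q\<bar> * ((h G n)\<^sup>2 / 4)))" using elim(2) y0 by simp
        ultimately show ?case by (rule less_le_trans[rotated])
      qed
    qed
  next
    fix y assume "ereal L < y"
    then obtain y0 where y0: "ereal L < ereal y0" "ereal y0 < y" using ereal_dense2 by blast
    \<comment> \<open>On this side L < z gives \<kappa> < G, so that n nodes are enough, and z < y0
      absorbs the factor 1 / (1 - |q| h^2/4).\<close>
    define z where "z = (y0 + L) / 2"
    have z: "L < z" "z < y0" "z > 0" using y0(1) L0 by (auto simp: z_def)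
    define G where "G = (4 * z) powr (real ?d / 2)"
    have G: "G > 0" "(1/4) * G powr (2 / real ?d) = z" unfolding G_def using G_of[OF z(3)] by auto
    have "\<kappa> < G" unfolding G_def \<kappa>_of using z L0 by (intro powr_less_mono2) auto
    from good_nodes[OF assms(1,2) ne this[unfolded \<kappa>_def]]
    have "\<forall>\<^sub>F n in sequentially. \<exists>\<xi>. finite \<xi> \<and> \<xi> \<subseteq> \<Omega> \<and> real (card \<xi>) * h G n ^ ?d \<le> G \<and>
      (\<forall>x\<in>\<Omega>. \<exists>z\<in>\<xi>. dist x z \<le> h G n) \<and> (\<forall>x\<in>frontier \<Omega>. \<exists>z\<in>\<xi>. dist x z \<le> h G n / 2)"
      using hlim[OF G(1)] by (rule eventually_compose_filterlim)
    moreover have "(\<lambda>n. \<bar>q\<bar> * ((h G n)\<^sup>2 / 4)) \<longlonglongrightarrow> \<bar>q\<bar> * 0"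
      by (intro tendsto_mult tendsto_const h2lim G)
    from order_tendstoD(2)[OF this, of 1]
    have "\<forall>\<^sub>F n in sequentially. \<bar>q\<bar> * ((h G n)\<^sup>2 / 4) < 1" by simp
    moreover have "(\<lambda>n. z / (1 - \<bar>q\<bar> * ((h G n)\<^sup>2 / 4))) \<longlonglongrightarrow> z / (1 - \<bar>q\<bar> * 0)"
      by (intro tendsto_intros h2lim G) auto
    then have "\<forall>\<^sub>F n in sequentially. z / (1 - \<bar>q\<bar> * ((h G n)\<^sup>2 / 4)) < y0"
      using z by (intro order_tendstoD) auto
    ultimately show "\<forall>\<^sub>F n in sequentially. ?a n < y" using eventually_gt_at_top[of 0]
    proof eventually_elim
      case (elim n)
      note S = step_size[OF G(1) d elim(4), folded h_def]
      let ?v = "((h G n)\<^sup>2 / 4) / (1 - \<bar>q\<bar> * ((h G n)\<^sup>2 / 4))"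
      obtain \<xi> where \<xi>: "finite \<xi>" "\<xi> \<subseteq> \<Omega>" "real (card \<xi>) * h G n ^ ?d \<le> G"
        "\<And>x. x \<in> \<Omega> \<Longrightarrow> \<exists>z\<in>\<xi>. dist x z \<le> h G n" "\<And>x. x \<in> frontier \<Omega> \<Longrightarrow> \<exists>z\<in>\<xi>. dist x z \<le> h G n / 2"
        using elim(1) by blast
      have "card \<xi> \<le> n"
        using \<xi>(3) elim(4) G(1) unfolding S(2) by (simp add: field_simps)
      then have "optimal_recovery \<Omega> 0 q n \<le> recovery_error \<Omega> 0 q \<xi>"
        unfolding optimal_recovery_def using \<xi>(1,2) by (intro INF_lower) auto
      also have "\<dots> \<le> ereal ?v"
        by (rule recovery_error_le[OF assms \<xi>(2,4,5) elim(2)])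
      finally have "?a n \<le> ereal (real n powr (2 / real ?d)) * ereal ?v"
        by (intro ereal_mult_left_mono) auto
      also have "\<dots> = ereal (real n powr (2 / real ?d) * ?v)" by simp
      also have "real n powr (2 / real ?d) * ?v = z / (1 - \<bar>q\<bar> * ((h G n)\<^sup>2 / 4))"
      proof -
        have "real n powr (2 / real ?d) * ?v = ((1/4) * (real n powr (2 / real ?d) * (h G n)\<^sup>2)) / (1 - \<bar>q\<bar> * ((h G n)\<^sup>2 / 4))"
          by simp
        then show ?thesis unfolding S(3) G(2) .
      qed
      also have "ereal \<dots> < ereal y0" using elim(3) by simp
      finally show ?case using y0(2) by simp
    qed
  qed
  moreover have "measure lborel (ball (0::'a) 1) = ?\<nu>" by (simp add: content_ball)
  ultimately show ?thesis by (simp add: L_def \<kappa>_def)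
qed

end
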